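(* Let $G$ be a VPT graph and let $h\geq 3$. If $G$ is a minimal non $[h,2,1]$ graph, then $G\in[h+1,2,1]$.
   Context: All graphs are finite, simple and connected. A VPT representation of $G$ is a tree $T$ (the host tree) together with paths $(P_v)_{v\in V(G)}$ of $T$ such that $uv\in E(G)$ iff $P_u$ and $P_v$ share at least one vertex; $G$ is VPT if it has such a representation. For an integer $h$, $[h,2,1]$ is the class of graphs admitting a VPT representation whose host tree has maximum degree at most $h$. A minimal non $[h,2,1]$ graph is a graph $G$ with $G\notin[h,2,1]$ and $G-v\in[h,2,1]$ for every $v\in V(G)$. *)

theory Defs
  imports "Graph_Theory.Graph_Theory"
begin

text \<open>
  A finite simple undirected graph is a digraph satisfying the locale predicate
  \<^const>\<open>graph\<close>: finite, loop-free, without parallel arcs, and with a symmetric arc set,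
  an edge being a pair of opposite arcs.  Hence the out-degree is the usual degree, and
  traversing one edge back and forth is a directed cycle of length 2.  The library's
  \<^const>\<open>tree\<close> forbids those too, so it does not describe undirected trees; here
  only cycles of length at least 3 are excluded.
\<close>

definition undirected_tree :: "('a, 'b) pre_digraph \<Rightarrow> bool" where
  "undirected_tree T \<longleftrightarrow>
     graph T \<and> connected T \<and> \<not> (\<exists>p. pre_digraph.cycle T p \<and> 3 \<le> length p)"

text \<open>
  A path of the host tree is given by its nonempty list of distinct vertices; it may consist
  of a single vertex.
\<close>

definition VPT_representation ::
    "('a, 'b) pre_digraph \<Rightarrow> ('t, 'e) pre_digraph \<Rightarrow> ('a \<Rightarrow> 't list) \<Rightarrow> bool" where
  "VPT_representation G T P \<longleftrightarrow>
     undirected_tree T \<and>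
     (\<forall>v \<in> verts G. vpath (P v) T) \<and>
     (\<forall>u \<in> verts G. \<forall>v \<in> verts G. u \<noteq> v \<longrightarrow>
        (u \<rightarrow>\<^bsub>G\<^esub> v \<longleftrightarrow> set (P u) \<inter> set (P v) \<noteq> {}))"

text \<open>
  Host trees are finite, so taking their vertices to be natural numbers is no restriction.
  Connectedness is not part of membership in the two classes below, because it need not be
  inherited by vertex-deleted subgraphs.
\<close>

definition VPT :: "('a, 'b) pre_digraph set" where
  "VPT = {G. graph G \<and> (\<exists>(T :: nat pair_pre_digraph) P. VPT_representation G (with_proj T) P)}"

definition class_h21 :: "nat \<Rightarrow> ('a, 'b) pre_digraph set" where
  "class_h21 h = {G. graph G \<and> (\<exists>(T :: nat pair_pre_digraph) P.
     VPT_representation G (with_proj T) P \<and>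
     (\<forall>x \<in> verts (with_proj T). out_degree (with_proj T) x \<le> h))}"

definition minimal_non_h21 :: "nat \<Rightarrow> ('a, 'b) pre_digraph \<Rightarrow> bool" where
  "minimal_non_h21 h G \<longleftrightarrow>
     G \<notin> class_h21 h \<and> (\<forall>v \<in> verts G. pre_digraph.del_vert G v \<in> class_h21 h)"

end

theory Submission
  imports Defs
begin

text \<open>
  Take a representation on a host tree \<open>T\<close> in which no edge \<open>pq\<close> can be contracted, so that
  some path contains \<open>p\<close> but not \<open>q\<close>.  Fix a vertex \<open>q\<close> of \<open>T\<close> and call two neighbours
  \<open>i\<close>, \<open>j\<close> of \<open>q\<close> in conflict if some path of the representation runs through \<open>i\<close>, \<open>q\<close>, \<open>j\<close>.
  If at every \<open>q\<close> the conflict graph is \<open>k\<close>-colourable with \<open>k \<ge> 3\<close>, then each \<open>q\<close> can be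
  replaced by a spider with one leg per colour, along which the branches of that colour are
  attached one after the other, and the new host tree has maximum degree at most \<open>k\<close>.

  It remains to colour the conflict graph with \<open>h + 1\<close> colours.  For each neighbour \<open>i\<close> choose
  \<open>w i\<close> whose path contains \<open>i\<close> but not \<open>q\<close>, delete one \<open>w i0\<close>, and take a representation of the
  rest on a tree of maximum degree \<open>h\<close>.  By the Helly property the clique \<open>C\<close> of all paths through
  \<open>q\<close> is represented by paths through one vertex \<open>q'\<close>, which no remaining \<open>w i\<close> contains.
  Colour \<open>i\<close> by the branch at \<open>q'\<close> holding \<open>w i\<close>.  Conflicting \<open>i\<close>, \<open>j\<close> of the same colour have
  nested neighbourhoods in \<open>C\<close>; but a neighbour \<open>i\<close> whose neighbourhood lies in that of \<open>j\<close>
  conflicts with \<open>j\<close> only, since a path through \<open>q\<close> enters at most two branches.  So \<open>i0\<close> and all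
  these \<open>i\<close> (one from each pair with equal neighbourhoods) can share one additional colour.
\<close>

section \<open>Trees described by edge cuts\<close>

text \<open>Acyclicity is expressed by making every edge a bridge: some vertex set is left through
  that edge alone. In this form it passes to contracted and expanded trees by transforming the
  witness set, without any reasoning about cycles.\<close>

locale cut_tree =
  fixes V :: "'t set" and E :: "'t rel"
  assumes finite_V: "finite V" and V_nonempty: "V \<noteq> {}"
    and E_subset: "E \<subseteq> V \<times> V"
    and E_sym: "(a, b) \<in> E \<Longrightarrow> (b, a) \<in> E"
    and E_conn: "x \<in> V \<Longrightarrow> y \<in> V \<Longrightarrow> (x, y) \<in> E\<^sup>*"
    and E_cut: "(u, v) \<in> E \<Longrightarrow>
      \<exists>S. u \<in> S \<and> v \<notin> S \<and> (\<forall>a b. (a, b) \<in> E \<longrightarrow> a \<in> S \<longrightarrow> b \<notin> S \<longrightarrow> a = u \<and> b = v)"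

definition tree_path :: "'t set \<Rightarrow> 't rel \<Rightarrow> 't list \<Rightarrow> bool" where
  "tree_path V E p \<longleftrightarrow> p \<noteq> [] \<and> distinct p \<and> set p \<subseteq> V \<and> successively (\<lambda>a b. (a, b) \<in> E) p"

text \<open>A discrete intermediate value argument. The step may go either way because it is not
  known whether \<open>x\<close> or \<open>y\<close> comes first on the list.\<close>

lemma successively_crossing:
  assumes "successively R p" "x \<in> set p" "x \<in> A" "y \<in> set p" "y \<notin> A"
  shows "\<exists>a b. a \<in> set p \<and> b \<in> set p \<and> a \<in> A \<and> b \<notin> A \<and> (R a b \<or> R b a)"
  using assms
proof (induction p arbitrary: x y)
  case Nil
  then show ?case by simp
next
  case (Cons z p)
  show ?case
  proof (cases "p = []")
    case True
    then show ?thesis using Cons.prems by auto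
  next
    case False
    then have R: "R z (hd p)" and s: "successively R p" and h: "hd p \<in> set p"
      using Cons.prems(1) by (auto simp: successively_Cons)
    show ?thesis
    proof (cases "z \<in> A \<longleftrightarrow> hd p \<in> A")
      case True
      have "\<exists>x y. x \<in> set p \<and> x \<in> A \<and> y \<in> set p \<and> y \<notin> A"
        using Cons.prems True h by auto
      then show ?thesis using Cons.IH[OF s] by fastforce
    next
      case False
      then show ?thesis using R h by fastforce
    qed
  qed
qed

lemma successively_rtrancl:
  assumes "successively (\<lambda>a b. (a, b) \<in> R) (x # p)" "y \<in> set (x # p)"
  shows "(x, y) \<in> R\<^sup>*"
  using assms
proof (induction p arbitrary: x)
  case (Cons z p)
  then show ?case by (auto intro: converse_rtrancl_into_rtrancl)
qed simp

lemma (in cut_tree) E_V: "(a, b) \<in> E \<Longrightarrow> a \<in> V" "(a, b) \<in> E \<Longrightarrow> b \<in> V"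
  using E_subset by auto

lemma (in cut_tree) E_irrefl: "(a, a) \<notin> E"
  using E_cut by blast

lemma (in cut_tree) finite_neighbours: "finite {r. (q, r) \<in> E}"
  by (rule finite_subset[OF _ finite_V]) (use E_V in auto)

text \<open>For an edge \<open>uv\<close> this is the component of the second argument
  \<open>v\<close> once the edge is removed, so \<open>side E q p\<close> is the branch at
  \<open>q\<close> that starts with the neighbour \<open>p\<close>.\<close>

definition side :: "'t rel \<Rightarrow> 't \<Rightarrow> 't \<Rightarrow> 't set" where
  "side E u v = {z. (v, z) \<in> (E - {(u, v), (v, u)})\<^sup>*}"

context cut_tree begin

lemma side_refl [simp]: "v \<in> side E u v"
  by (simp add: side_def)

lemma side_leave:
  assumes "a \<in> side E u v" "(a, b) \<in> E" "b \<notin> side E u v"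
  shows "(a = v \<and> b = u) \<or> (a = u \<and> b = v)"
proof (rule ccontr)
  assume "\<not> ?thesis"
  then have "(a, b) \<in> E - {(u, v), (v, u)}" using assms by auto
  then have "(v, b) \<in> (E - {(u, v), (v, u)})\<^sup>*"
    using assms(1) unfolding side_def by (auto intro: rtrancl_into_rtrancl)
  then show False using assms(3) by (simp add: side_def)
qed

text \<open>The cut set of the reversed edge contains \<open>v\<close>, and a walk that avoids the
  edge cannot leave it.\<close>

lemma notin_side:
  assumes "(u, v) \<in> E" shows "u \<notin> side E u v"
proof
  obtain S where S: "v \<in> S" "u \<notin> S"
    "\<And>a b. (a, b) \<in> E \<Longrightarrow> a \<in> S \<Longrightarrow> b \<notin> S \<Longrightarrow> a = v \<and> b = u"
    using E_cut[OF E_sym[OF assms]] by blast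
  have "z \<in> S" if "(v, z) \<in> (E - {(u, v), (v, u)})\<^sup>*" for z
    using that by induction (use S in blast)+
  moreover assume "u \<in> side E u v"
  ultimately show False using S by (simp add: side_def)
qed

lemma side_leave':
  assumes "(u, v) \<in> E" "a \<in> side E u v" "(a, b) \<in> E" "b \<notin> side E u v"
  shows "a = v \<and> b = u"
  using side_leave[OF assms(2-4)] notin_side[OF assms(1)] assms by auto

lemma side_disjoint:
  assumes "(u, v) \<in> E" "z \<in> side E u v" shows "z \<notin> side E v u"
proof
  assume "z \<in> side E v u"
  then have "(u, z) \<in> (E - {(u, v), (v, u)})\<^sup>*" by (simp add: side_def insert_commute)
  moreover have "sym (E - {(u, v), (v, u)})" using E_sym by (auto simp: sym_def)
  ultimately have "(z, u) \<in> (E - {(u, v), (v, u)})\<^sup>*" by (metis sym_rtrancl symE)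
  then have "u \<in> side E u v" using assms(2) by (auto simp: side_def)
  then show False using notin_side[OF assms(1)] by blast
qed

lemma side_cover:
  assumes "(u, v) \<in> E" "z \<in> V" shows "z \<in> side E u v \<or> z \<in> side E v u"
proof -
  have "(u, z) \<in> E\<^sup>*" using E_conn assms E_V by blast
  then show ?thesis
  proof induction
    case (step y z)
    then show ?case
      using side_leave[of y u v z] side_leave[of y v u z] side_refl[of u v] side_refl[of v u] by blast
  qed simp
qed

lemma side_subset: "(u, v) \<in> E \<Longrightarrow> side E u v \<subseteq> V"
proof
  fix z assume uv: "(u, v) \<in> E" and "z \<in> side E u v"
  then have "(v, z) \<in> (E - {(u, v), (v, u)})\<^sup>*" by (simp add: side_def)
  then show "z \<in> V" by induction (use uv E_V in auto)
qed

lemma branch_exists: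
  assumes "q \<in> V" "z \<in> V" "z \<noteq> q" shows "\<exists>p. (q, p) \<in> E \<and> z \<in> side E q p"
proof -
  have "(q, z) \<in> E\<^sup>*" using E_conn assms by blast
  then have "z = q \<or> (\<exists>p. (q, p) \<in> E \<and> z \<in> side E q p)"
  proof induction
    case (step y z)
    then show ?case using side_leave' side_refl by metis
  qed simp
  then show ?thesis using assms by blast
qed

text \<open>The branch of \<open>r\<close> can be entered only from \<open>q\<close>, and a walk
  inside the branch of \<open>p\<close> never visits \<open>q\<close>.\<close>

lemma branch_unique:
  assumes "(q, p) \<in> E" "(q, r) \<in> E" "z \<in> side E q p" "z \<in> side E q r" shows "p = r"
proof (rule ccontr)
  assume ne: "p \<noteq> r"
  have "(p, z) \<in> (E - {(q, p), (p, q)})\<^sup>*" using assms(3) by (simp add: side_def)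
  then have "z \<in> side E q p \<and> z \<notin> side E q r"
  proof induction
    case base
    have "p \<notin> side E q r"
      using side_leave'[OF assms(2), of p q] E_sym[OF assms(1)] notin_side[OF assms(2)] ne by blast
    then show ?case by simp
  next
    case (step a b)
    then have "b \<in> side E q p" unfolding side_def by (auto intro: rtrancl_into_rtrancl)
    moreover have "b \<notin> side E q r"
    proof
      assume "b \<in> side E q r"
      moreover have "(b, a) \<in> E" using step E_sym by blast
      ultimately have "a = q" using side_leave'[OF assms(2)] step by blast
      then show False using step notin_side[OF assms(1)] by blast
    qed
    ultimately show ?case ..
  qed
  then show False using assms by blast
qed

text \<open>Connectedness in the form of convexity: an edge separating two points of
  \<open>X\<close> has its ends in \<open>X\<close>. Asking for \<open>u\<close> suffices, since
  exchanging \<open>u\<close> and \<open>v\<close> gives the other end. The empty set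
  qualifies.\<close>

definition subtree :: "'t set \<Rightarrow> bool" where
  "subtree X \<longleftrightarrow> X \<subseteq> V \<and>
     (\<forall>u v x y. (u, v) \<in> E \<longrightarrow> x \<in> X \<longrightarrow> y \<in> X \<longrightarrow> x \<in> side E u v \<longrightarrow> y \<in> side E v u \<longrightarrow> u \<in> X)"

lemma subtreeD:
  assumes "subtree X" "(u, v) \<in> E" "x \<in> X" "y \<in> X" "x \<in> side E u v" "y \<in> side E v u"
  shows "u \<in> X" "v \<in> X"
  using assms E_sym unfolding subtree_def by blast+

lemma subtree_path:
  assumes "tree_path V E p" shows "subtree (set p)"
  unfolding subtree_def
proof (intro conjI allI impI)
  show "set p \<subseteq> V" using assms by (simp add: tree_path_def)
  fix u v x y
  assume a: "(u, v) \<in> E" "x \<in> set p" "y \<in> set p" "x \<in> side E u v" "y \<in> side E v u"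
  then have "y \<notin> side E u v" using side_disjoint E_sym by blast
  then obtain c d where cd: "c \<in> set p" "d \<in> set p" "c \<in> side E u v" "d \<notin> side E u v" "(c, d) \<in> E \<or> (d, c) \<in> E"
    using successively_crossing[of "\<lambda>a b. (a, b) \<in> E" p x "side E u v" y] a assms
    by (auto simp: tree_path_def)
  then have "(c, d) \<in> E" using E_sym by blast
  then show "u \<in> set p" using side_leave'[OF a(1) cd(3) _ cd(4)] cd by blast
qed

text \<open>A common point lies on one side of the given edge, so one of the two sets already has
  points on both sides.\<close>

lemma subtree_Un:
  assumes "subtree X" "subtree Y" "X \<inter> Y \<noteq> {}" shows "subtree (X \<union> Y)"
proof -
  obtain z where z: "z \<in> X" "z \<in> Y" using assms by blast
  have zV: "z \<in> V" using z assms by (auto simp: subtree_def)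
  show ?thesis
    unfolding subtree_def
  proof (intro conjI allI impI)
    show "X \<union> Y \<subseteq> V" using assms by (auto simp: subtree_def)
    fix u v x y
    assume a: "(u, v) \<in> E" "x \<in> X \<union> Y" "y \<in> X \<union> Y" "x \<in> side E u v" "y \<in> side E v u"
    show "u \<in> X \<union> Y"
      using side_cover[OF a(1) zV] subtreeD(1)[OF assms(1) a(1)] subtreeD(1)[OF assms(2) a(1)] a z by blast
  qed
qed

lemma subtree_in_branch:
  assumes "subtree X" "(q, p) \<in> E" "q \<notin> X" "x \<in> X" "x \<in> side E q p" shows "X \<subseteq> side E q p"
  using side_cover[OF assms(2)] subtreeD(1)[OF assms(1,2,4) _ assms(5)] assms(1,3)
  unfolding subtree_def by blast

text \<open>Without a common vertex, every vertex has a branch that contains a whole member of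
  \<open>F\<close>. Take such a branch of least size, from \<open>q\<close> towards
  \<open>p\<close>. The branch chosen at \<open>p\<close> either points back to \<open>q\<close>,
  which yields two disjoint members, or is strictly smaller.\<close>

lemma helly:
  assumes sub: "\<And>X. X \<in> F \<Longrightarrow> subtree X" and ne: "\<And>X. X \<in> F \<Longrightarrow> X \<noteq> {}"
    and int: "\<And>X Y. X \<in> F \<Longrightarrow> Y \<in> F \<Longrightarrow> X \<inter> Y \<noteq> {}"
  shows "\<exists>q\<in>V. \<forall>X\<in>F. q \<in> X"
proof (rule ccontr)
  assume "\<not> ?thesis"
  then have ex: "\<exists>X\<in>F. q \<notin> X" if "q \<in> V" for q using that by blast
  have arc: "\<exists>p X. (q, p) \<in> E \<and> X \<in> F \<and> X \<subseteq> side E q p" if q: "q \<in> V" for q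
  proof -
    obtain X where X: "X \<in> F" "q \<notin> X" using ex[OF q] by blast
    then obtain x where x: "x \<in> X" using ne by blast
    then have "x \<in> V" "x \<noteq> q" using sub[OF X(1)] X(2) by (auto simp: subtree_def)
    then obtain p where p: "(q, p) \<in> E" "x \<in> side E q p" using branch_exists[OF q, of x] by blast
    show ?thesis using subtree_in_branch[OF sub[OF X(1)] p(1) X(2) x p(2)] X(1) p(1) by blast
  qed
  let ?Q = "\<lambda>(q, p). (q, p) \<in> E \<and> (\<exists>X\<in>F. X \<subseteq> side E q p)"
  obtain v where v: "v \<in> V" using V_nonempty by blast
  obtain w X where "(v, w) \<in> E \<and> X \<in> F \<and> X \<subseteq> side E v w" using arc[OF v] by blast
  then have "?Q (v, w)" by auto
  then obtain e where e: "?Q e" and least: "\<And>e'. ?Q e' \<Longrightarrow> card (case_prod (side E) e) \<le> card (case_prod (side E) e')"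
    using ex_has_least_nat[of ?Q "(v, w)" "\<lambda>e. card (case_prod (side E) e)"] by blast
  obtain q p where qp: "e = (q, p)" by force
  obtain X where X: "(q, p) \<in> E" "X \<in> F" "X \<subseteq> side E q p" using e qp by auto
  obtain r Y where Y: "(p, r) \<in> E" "Y \<in> F" "Y \<subseteq> side E p r" using arc[OF E_V(2)[OF X(1)]] by blast
  have "r \<noteq> q"
  proof
    assume "r = q"
    then have "X \<inter> Y = {}" using X(3) Y(3) side_disjoint[OF X(1)] by blast
    then show False using int[OF X(2) Y(2)] by contradiction
  qed
  have "side E p r \<subseteq> side E q p"
  proof
    fix z assume z: "z \<in> side E p r"
    then have "z \<notin> side E p q" using branch_unique[OF Y(1) E_sym[OF X(1)]] \<open>r \<noteq> q\<close> by blast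
    then show "z \<in> side E q p" using side_cover[OF X(1)] side_subset[OF Y(1)] z by blast
  qed
  moreover have "p \<in> side E q p" "p \<notin> side E p r" using notin_side[OF Y(1)] by auto
  ultimately have "side E p r \<subset> side E q p" by blast
  then have "card (side E p r) < card (side E q p)"
    using psubset_card_mono finite_subset[OF side_subset[OF X(1)] finite_V] by blast
  then show False using least[of "(p, r)"] Y qp by auto
qed

section \<open>Paths seen from one of their vertices\<close>

lemma walk_in_side:
  assumes "(u, v) \<in> E" "successively (\<lambda>a b. (a, b) \<in> E) (v # p)" "u \<notin> set p"
  shows "set (v # p) \<subseteq> side E u v"
proof -
  have *: "set p \<subseteq> side E u v"
    if "successively (\<lambda>a b. (a, b) \<in> E) (y # p)" "u \<notin> set p" "y \<in> side E u v" for y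
    using that
  proof (induction p arbitrary: y)
    case (Cons z p)
    then have "z \<in> side E u v" using side_leave'[OF assms(1), of y z] by auto
    then show ?case using Cons by auto
  qed simp
  show ?thesis using *[OF assms(2,3)] by simp
qed

lemma tree_path_rev: "tree_path V E p \<Longrightarrow> tree_path V E (rev p)"
  unfolding tree_path_def
  by (simp add: successively_rev) (metis (mono_tags, lifting) E_sym successively_mono)

lemma path_tail_in_branch:
  assumes "tree_path V E (xs @ q # ys)" "ys \<noteq> []"
  shows "(q, hd ys) \<in> E" "set ys \<subseteq> side E q (hd ys)"
proof -
  obtain y zs where ys: "ys = y # zs" using assms by (cases ys) auto
  have s: "successively (\<lambda>a b. (a, b) \<in> E) (q # ys)" and "q \<notin> set ys"
    using assms by (auto simp: tree_path_def successively_append_iff)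
  then show "(q, hd ys) \<in> E" "set ys \<subseteq> side E q (hd ys)"
    using walk_in_side[of q y zs] ys by auto
qed

lemma path_head_in_branch:
  assumes "tree_path V E (xs @ q # ys)" "xs \<noteq> []"
  shows "(q, last xs) \<in> E" "set xs \<subseteq> side E q (last xs)"
  using path_tail_in_branch[of "rev ys" q "rev xs"] tree_path_rev[OF assms(1)] assms(2)
  by (auto simp: hd_rev)

text \<open>Each half of the path lies in a single branch at \<open>q\<close>, and the only
  neighbour of \<open>q\<close> in a branch is the vertex at which it starts.\<close>

lemma path_neighbour:
  assumes "tree_path V E (xs @ q # ys)" "(q, r) \<in> E" "r \<in> set (xs @ q # ys)"
  shows "xs \<noteq> [] \<and> r = last xs \<or> ys \<noteq> [] \<and> r = hd ys"
proof -
  have "r \<noteq> q" using assms(2) E_irrefl by blast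
  then consider "r \<in> set xs" | "r \<in> set ys" using assms(3) by auto
  then show ?thesis
  proof cases
    case 1
    then show ?thesis
      using path_head_in_branch[OF assms(1)] branch_unique[OF _ assms(2), of "last xs" r] side_refl by fastforce
  next
    case 2
    then show ?thesis
      using path_tail_in_branch[OF assms(1)] branch_unique[OF _ assms(2), of "hd ys" r] side_refl by fastforce
  qed
qed

lemma path_two_neighbours:
  assumes "tree_path V E p" "q \<in> set p" "{i, j, k} \<subseteq> set p"
    "(q, i) \<in> E" "(q, j) \<in> E" "(q, k) \<in> E"
  shows "i = j \<or> j = k \<or> i = k"
proof -
  obtain xs ys where "p = xs @ q # ys" using assms(2) by (meson split_list)
  then show ?thesis using path_neighbour[of xs q ys] assms by (metis insert_subset)
qed

text \<open>The edge from \<open>a\<close> to its successor on the path separates \<open>x\<close>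
  from \<open>y\<close>.\<close>

lemma subtree_between:
  assumes "tree_path V E (xs @ a # ys)" "x \<in> set xs" "y \<in> set ys" "subtree X" "x \<in> X" "y \<in> X"
  shows "a \<in> X"
proof -
  obtain y' zs where ys: "ys = y' # zs" using assms by (cases ys) auto
  have e: "(a, y') \<in> E" and "y \<in> side E a y'"
    using path_tail_in_branch[OF assms(1)] ys assms by auto
  moreover have "x \<in> side E y' a"
    using path_head_in_branch(2)[of "xs @ [a]" y' zs] assms(1,2) ys by auto
  ultimately show ?thesis using subtreeD(1)[OF assms(4) e] assms by blast
qed

text \<open>Of two disjoint subtrees met by a path starting at \<open>q\<close>, the first one met
  blocks the way from \<open>q\<close> to the second.\<close>

lemma nested_in_branch:
  assumes Z: "tree_path V E Z" "q \<in> set Z" and c: "(q, c) \<in> E"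
    and X: "subtree X" "X \<subseteq> side E q c" "set Z \<inter> X \<noteq> {}"
    and Y: "subtree Y" "Y \<subseteq> side E q c" "set Z \<inter> Y \<noteq> {}"
    and disj: "X \<inter> Y = {}"
  shows "(\<forall>U. subtree U \<longrightarrow> q \<in> U \<longrightarrow> U \<inter> Y \<noteq> {} \<longrightarrow> U \<inter> X \<noteq> {}) \<or>
         (\<forall>U. subtree U \<longrightarrow> q \<in> U \<longrightarrow> U \<inter> X \<noteq> {} \<longrightarrow> U \<inter> Y \<noteq> {})"
proof -
  \<comment> \<open>If \<open>U\<close> meets \<open>Y\<close>, then \<open>U \<union> Y\<close> is
    a subtree containing \<open>q\<close> and \<open>y\<close>, hence also \<open>x\<close>, which
    lies between them; as \<open>x\<close> is not in \<open>Y\<close>, it is in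
    \<open>U\<close>.\<close>
  have aux: "U \<inter> X \<noteq> {}"
    if p: "tree_path V E (ls @ q # A @ x # B)" and x: "x \<in> X" and y: "y \<in> Y" "y \<in> set B"
      and sY: "subtree Y" and d: "X \<inter> Y = {}" and U: "subtree U" "q \<in> U" "U \<inter> Y \<noteq> {}"
    for ls A x B y X Y U
  proof -
    have "x \<in> U \<union> Y"
      using subtree_between[of "ls @ q # A" x B q y "U \<union> Y"] p y U subtree_Un[OF U(1) sY] by auto
    then show ?thesis using x d by blast
  qed
  have aux2: ?thesis
    if p: "tree_path V E (ls @ q # rs)" and x: "x \<in> X" "x \<in> set rs" and y: "y \<in> Y" "y \<in> set rs"
    for ls rs x y
  proof -
    obtain A B where AB: "rs = A @ x # B" using x by (meson split_list)
    have "y \<noteq> x" using x y disj by blast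
    then consider "y \<in> set B" | "y \<in> set A" using y AB by auto
    then show ?thesis
    proof cases
      case 1
      have "U \<inter> X \<noteq> {}" if "subtree U" "q \<in> U" "U \<inter> Y \<noteq> {}" for U
        using aux[of ls A x B X y Y U] 1 p x y Y(1) disj AB that by auto
      then show ?thesis by blast
    next
      case 2
      then obtain A1 A2 where "A = A1 @ y # A2" by (meson split_list)
      then have "tree_path V E (ls @ q # A1 @ y # (A2 @ x # B))" using p AB by simp
      then have "U \<inter> Y \<noteq> {}" if "subtree U" "q \<in> U" "U \<inter> X \<noteq> {}" for U
        using aux[of ls A1 y "A2 @ x # B" Y x X U] x y X(1) disj that by auto
      then show ?thesis by blast
    qed
  qed
  obtain ls rs where lr: "Z = ls @ q # rs" using Z by (meson split_list)
  obtain x y where xy: "x \<in> X" "x \<in> set Z" "y \<in> Y" "y \<in> set Z" using X Y by blast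
  have nq: "q \<notin> X" "q \<notin> Y" using X Y notin_side[OF c] by auto
  have p: "tree_path V E (ls @ q # rs)" and p': "tree_path V E (rev rs @ q # rev ls)"
    using Z lr tree_path_rev[of Z] by auto
  have l: "c = last ls \<and> ls \<noteq> []" if "z \<in> set ls" "z \<in> side E q c" for z
  proof -
    have ne: "ls \<noteq> []" using that(1) by auto
    show ?thesis
      using branch_unique[OF c path_head_in_branch(1)[OF p ne] that(2)]
        path_head_in_branch(2)[OF p ne] that(1) ne by blast
  qed
  have r: "c = hd rs \<and> rs \<noteq> []" if "z \<in> set rs" "z \<in> side E q c" for z
  proof -
    have ne: "rs \<noteq> []" using that(1) by auto
    show ?thesis
      using branch_unique[OF c path_tail_in_branch(1)[OF p ne] that(2)]
        path_tail_in_branch(2)[OF p ne] that(1) ne by blast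
  qed
  \<comment> \<open>The vertex \<open>c\<close> occurs only once on \<open>Z\<close>, so
    \<open>X\<close> and \<open>Y\<close> are met on the same side of \<open>q\<close>; reversing
    the list reduces one side to the other.\<close>
  have "\<not> (c = last ls \<and> ls \<noteq> [] \<and> c = hd rs \<and> rs \<noteq> [])"
  proof
    assume *: "c = last ls \<and> ls \<noteq> [] \<and> c = hd rs \<and> rs \<noteq> []"
    then have "c \<in> set ls" "c \<in> set rs" by (metis last_in_set, metis hd_in_set)
    then show False using p by (auto simp: tree_path_def)
  qed
  moreover have "x \<in> set ls \<or> x \<in> set rs" "y \<in> set ls \<or> y \<in> set rs"
    using xy nq lr by auto
  moreover have "x \<in> side E q c" "y \<in> side E q c" using xy X(2) Y(2) by auto
  ultimately consider "x \<in> set ls" "y \<in> set ls" | "x \<in> set rs" "y \<in> set rs"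
    using l r by blast
  then show ?thesis
  proof cases
    case 1
    then show ?thesis using aux2[OF p' xy(1) _ xy(3)] by simp
  next
    case 2
    then show ?thesis using aux2[OF p xy(1) _ xy(3)] by simp
  qed
qed

end

section \<open>Contracting superfluous edges\<close>

text \<open>The vertex set \<open>W\<close> is kept apart from the adjacency predicate
  \<open>A\<close>, so that deleting a vertex only shrinks \<open>W\<close>.\<close>

definition path_rep :: "'a set \<Rightarrow> ('a \<Rightarrow> 'a \<Rightarrow> bool) \<Rightarrow> 't set \<Rightarrow> 't rel \<Rightarrow> ('a \<Rightarrow> 't list) \<Rightarrow> bool"
  where
  "path_rep W A V E P \<longleftrightarrow> cut_tree V E \<and> (\<forall>v\<in>W. tree_path V E (P v)) \<and>
     (\<forall>u\<in>W. \<forall>v\<in>W. u \<noteq> v \<longrightarrow> (A u v \<longleftrightarrow> set (P u) \<inter> set (P v) \<noteq> {}))"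

text \<open>As \<open>E\<close> is symmetric, the condition applies to each edge in both
  orientations, and both are needed when the branches are coloured.\<close>

definition reduced_rep :: "'a set \<Rightarrow> 't rel \<Rightarrow> ('a \<Rightarrow> 't list) \<Rightarrow> bool" where
  "reduced_rep W E P \<longleftrightarrow> (\<forall>p q. (p, q) \<in> E \<longrightarrow> (\<exists>w\<in>W. p \<in> set (P w) \<and> q \<notin> set (P w)))"

definition merge :: "'t \<Rightarrow> 't \<Rightarrow> 't \<Rightarrow> 't" where
  "merge p q x = (if x = p then q else x)"

definition contract :: "'t \<Rightarrow> 't \<Rightarrow> 't rel \<Rightarrow> 't rel" where
  "contract p q E = {(merge p q a, merge p q b) | a b. (a, b) \<in> E \<and> merge p q a \<noteq> merge p q b}"

lemma contractI:
  "(a, b) \<in> E \<Longrightarrow> merge p q a \<noteq> merge p q b \<Longrightarrow> (merge p q a, merge p q b) \<in> contract p q E"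
  unfolding contract_def by blast

context cut_tree begin

text \<open>An edge that survives is different from \<open>pq\<close>, so its cut set contains both
  or neither of \<open>p\<close> and \<open>q\<close>. The same set therefore cuts the image of the
  edge.\<close>

lemma contract_tree:
  assumes pq: "(p, q) \<in> E" shows "cut_tree (V - {p}) (contract p q E)"
proof
  have ne: "p \<noteq> q" using pq E_irrefl by blast
  have q: "q \<in> V - {p}" using pq ne E_V by blast
  show "finite (V - {p})" using finite_V by simp
  show "V - {p} \<noteq> {}" using q by blast
  show "contract p q E \<subseteq> (V - {p}) \<times> (V - {p})"
  proof
    fix e assume "e \<in> contract p q E"
    then obtain a b where "(a, b) \<in> E" "e = (merge p q a, merge p q b)" by (auto simp: contract_def)
    then show "e \<in> (V - {p}) \<times> (V - {p})" using E_V[of a b] q by (simp add: merge_def)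
  qed
  show "(b, a) \<in> contract p q E" if "(a, b) \<in> contract p q E" for a b
  proof -
    obtain c d where "(c, d) \<in> E" "a = merge p q c" "b = merge p q d" "a \<noteq> b"
      using \<open>(a, b) \<in> contract p q E\<close> by (auto simp: contract_def)
    then show ?thesis using contractI[OF E_sym[of c d], of p q] by simp
  qed
  show "(x, y) \<in> (contract p q E)\<^sup>*" if "x \<in> V - {p}" "y \<in> V - {p}" for x y
  proof -
    have "(x, y) \<in> E\<^sup>*" using that E_conn by blast
    then have "(merge p q x, merge p q y) \<in> (contract p q E)\<^sup>*"
    proof induction
      case (step a b)
      show ?case
      proof (cases "merge p q a = merge p q b")
        case False
        then have "(merge p q a, merge p q b) \<in> contract p q E"
          using step by (intro contractI)
        then show ?thesis using step.IH by (rule rtrancl_into_rtrancl[rotated])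
      qed (use step in simp)
    qed simp
    then show ?thesis using that by (simp add: merge_def)
  qed
  fix u v assume "(u, v) \<in> contract p q E"
  then obtain a b where ab: "(a, b) \<in> E" "u = merge p q a" "v = merge p q b" "u \<noteq> v"
    by (auto simp: contract_def)
  obtain S where S: "a \<in> S" "b \<notin> S"
    "\<And>c d. (c, d) \<in> E \<Longrightarrow> c \<in> S \<Longrightarrow> d \<notin> S \<Longrightarrow> c = a \<and> d = b"
    using E_cut[OF ab(1)] by blast
  have "\<not> (p = a \<and> q = b)" "\<not> (q = a \<and> p = b)" using ab ne by (auto simp: merge_def)
  then have "p \<in> S \<longleftrightarrow> q \<in> S" using S(3)[OF pq] S(3)[OF E_sym[OF pq]] by blast
  then have m: "merge p q x \<in> S \<longleftrightarrow> x \<in> S" for x by (simp add: merge_def)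
  show "\<exists>S. u \<in> S \<and> v \<notin> S \<and>
    (\<forall>c d. (c, d) \<in> contract p q E \<longrightarrow> c \<in> S \<longrightarrow> d \<notin> S \<longrightarrow> c = u \<and> d = v)"
  proof (intro exI[of _ S] conjI allI impI)
    show "u \<in> S" "v \<notin> S" using S(1,2) ab m by auto
    fix c d assume "(c, d) \<in> contract p q E" "c \<in> S" "d \<notin> S"
    then obtain c' d' where cd: "(c', d') \<in> E" "c = merge p q c'" "d = merge p q d'"
      "c' \<in> S" "d' \<notin> S" using m unfolding contract_def by blast
    then have "c' = a" "d' = b" using S(3)[of c' d'] by simp_all
    then show "c = u" "d = v" using ab cd by simp_all
  qed
qed

lemma contract_arcI:
  "(a, b) \<in> E \<Longrightarrow> a \<noteq> p \<Longrightarrow> b \<noteq> p \<Longrightarrow> (a, b) \<in> contract p q E"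
  "(p, b) \<in> E \<Longrightarrow> b \<noteq> p \<Longrightarrow> b \<noteq> q \<Longrightarrow> (q, b) \<in> contract p q E"
  "(a, p) \<in> E \<Longrightarrow> a \<noteq> p \<Longrightarrow> a \<noteq> q \<Longrightarrow> (a, q) \<in> contract p q E"
proof -
  show "(a, b) \<in> contract p q E" if "(a, b) \<in> E" "a \<noteq> p" "b \<noteq> p"
    using contractI[OF that(1), of p q] that E_irrefl by (cases "a = b") (simp_all add: merge_def)
  show "(q, b) \<in> contract p q E" if "(p, b) \<in> E" "b \<noteq> p" "b \<noteq> q"
    using contractI[OF that(1), of p q] that by (simp add: merge_def)
  show "(a, q) \<in> contract p q E" if "(a, p) \<in> E" "a \<noteq> p" "a \<noteq> q"
    using contractI[OF that(1), of p q] that by (simp add: merge_def)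
qed

lemma contract_walk:
  assumes "successively (\<lambda>a b. (a, b) \<in> E) xs" "p \<notin> set xs"
  shows "successively (\<lambda>a b. (a, b) \<in> contract p q E) xs"
proof (rule successively_mono[OF assms(1)])
  fix a b assume "(a, b) \<in> E" "a \<in> set xs" "b \<in> set xs"
  then show "(a, b) \<in> contract p q E" using contract_arcI(1)[of a b p q] assms(2) by fastforce
qed

text \<open>If \<open>p\<close> is on the path then \<open>q\<close> is next to it, by
  \<open>path_neighbour\<close>. Dropping \<open>p\<close> makes \<open>q\<close> adjacent to the
  vertex on the other side of \<open>p\<close>, if there is one, and this is an edge after
  contraction.\<close>

lemma contract_path:
  assumes pq: "(p, q) \<in> E" and xs: "tree_path V E l" and p: "p \<in> set l \<Longrightarrow> q \<in> set l"
  shows "tree_path (V - {p}) (contract p q E) (filter (\<lambda>x. x \<noteq> p) l)"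
proof (cases "p \<in> set l")
  case False
  then have "filter (\<lambda>x. x \<noteq> p) l = l" by (auto intro: filter_True)
  then show ?thesis using contract_walk[of l p q] xs False by (auto simp: tree_path_def)
next
  case True
  obtain xs ys where l: "l = xs @ p # ys" using True by (meson split_list)
  have d: "p \<notin> set xs" "p \<notin> set ys" "set xs \<inter> set ys = {}"
    using assms(2) l by (auto simp: tree_path_def)
  have f: "filter (\<lambda>x. x \<noteq> p) l = xs @ ys"
  proof -
    have "filter (\<lambda>x. x \<noteq> p) xs = xs" "filter (\<lambda>x. x \<noteq> p) ys = ys"
      using d by (auto simp: filter_id_conv)
    then show ?thesis using l by simp
  qed
  have nb: "xs \<noteq> [] \<and> q = last xs \<or> ys \<noteq> [] \<and> q = hd ys"
    using path_neighbour[of xs p ys q] assms True l by blast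
  have s: "successively (\<lambda>a b. (a, b) \<in> E) xs" "successively (\<lambda>a b. (a, b) \<in> E) ys"
    "xs \<noteq> [] \<Longrightarrow> (last xs, p) \<in> E" "ys \<noteq> [] \<Longrightarrow> (p, hd ys) \<in> E"
    using xs unfolding l tree_path_def by (auto simp: successively_append_iff successively_Cons)
  have "(last xs, hd ys) \<in> contract p q E" if "xs \<noteq> []" "ys \<noteq> []"
  proof -
    have m: "last xs \<in> set xs" "hd ys \<in> set ys" using that by auto
    then have n: "last xs \<noteq> p" "hd ys \<noteq> p" "last xs \<noteq> hd ys" using d by auto
    from nb show ?thesis
    proof
      assume "xs \<noteq> [] \<and> q = last xs"
      then show ?thesis using contract_arcI(2)[OF s(4)] that n by simp
    next
      assume "ys \<noteq> [] \<and> q = hd ys"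
      then show ?thesis using contract_arcI(3)[OF s(3)] that n by simp
    qed
  qed
  then have "successively (\<lambda>a b. (a, b) \<in> contract p q E) (xs @ ys)"
    using contract_walk[OF s(1) d(1)] contract_walk[OF s(2) d(2)] by (auto simp: successively_append_iff)
  moreover have "xs @ ys \<noteq> []" using nb by auto
  ultimately show ?thesis using f d xs l by (auto simp: tree_path_def)
qed

end

text \<open>Two paths that meet in \<open>p\<close> also meet in \<open>q\<close>, so dropping
  \<open>p\<close> loses no intersection.\<close>

lemma contract_rep:
  assumes rep: "path_rep W A V E P" and pq: "(p, q) \<in> E"
    and sub: "\<And>w. w \<in> W \<Longrightarrow> p \<in> set (P w) \<Longrightarrow> q \<in> set (P w)"
  shows "path_rep W A (V - {p}) (contract p q E) (\<lambda>w. filter (\<lambda>x. x \<noteq> p) (P w))"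
proof -
  interpret cut_tree V E using rep by (simp add: path_rep_def)
  have ne: "p \<noteq> q" using pq E_irrefl by blast
  have "{x \<in> set (P u). x \<noteq> p} \<inter> {x \<in> set (P v). x \<noteq> p} \<noteq> {} \<longleftrightarrow> set (P u) \<inter> set (P v) \<noteq> {}"
    if "u \<in> W" "v \<in> W" for u v
    using sub[OF that(1)] sub[OF that(2)] ne by blast
  then show ?thesis
    using rep contract_tree[OF pq] contract_path[OF pq] sub unfolding path_rep_def by auto
qed

text \<open>A representation with the fewest host vertices is reduced, since an edge violating the
  condition could be contracted.\<close>

lemma exists_reduced_rep:
  fixes V0 :: "'t set"
  assumes "path_rep W A V0 E0 P0"
  obtains V :: "'t set" and E P where "path_rep W A V E P" "reduced_rep W E P"
proof -
  let ?R = "\<lambda>(V :: 't set, E, P). path_rep W A V E P"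
  have "?R (V0, E0, P0)" using assms by simp
  then obtain T where T: "?R T" and least: "\<And>T'. ?R T' \<Longrightarrow> card (fst T) \<le> card (fst T')"
    using ex_has_least_nat[of ?R "(V0, E0, P0)" "\<lambda>T. card (fst T)"] by blast
  obtain V E P where VEP: "T = (V, E, P)" by (cases T)
  have rep: "path_rep W A V E P" using T VEP by simp
  interpret cut_tree V E using rep by (simp add: path_rep_def)
  have "reduced_rep W E P"
    unfolding reduced_rep_def
  proof (intro allI impI, rule ccontr)
    fix p q assume pq: "(p, q) \<in> E" and n: "\<not> (\<exists>w\<in>W. p \<in> set (P w) \<and> q \<notin> set (P w))"
    have "path_rep W A (V - {p}) (contract p q E) (\<lambda>w. filter (\<lambda>x. x \<noteq> p) (P w))"
      using contract_rep[OF rep pq] n by blast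
    then have "card V \<le> card (V - {p})"
      using least[of "(V - {p}, contract p q E, \<lambda>w. filter (\<lambda>x. x \<noteq> p) (P w))"] VEP by simp
    moreover have "card (V - {p}) < card V"
      using finite_V E_V(1)[OF pq] by (rule card_Diff1_less)
    ultimately show False by simp
  qed
  then show ?thesis using that rep by blast
qed

section \<open>Colouring the branches at a vertex\<close>

lemma path_repD:
  assumes "path_rep W A V E P"
  shows "cut_tree V E" "v \<in> W \<Longrightarrow> tree_path V E (P v)"
    "u \<in> W \<Longrightarrow> v \<in> W \<Longrightarrow> u \<noteq> v \<Longrightarrow> A u v \<longleftrightarrow> set (P u) \<inter> set (P v) \<noteq> {}"
  using assms unfolding path_rep_def by blast+

text \<open>The path of \<open>w\<close> stays in the branch of \<open>i\<close>, and a path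
  containing \<open>q\<close> can reach that branch only through \<open>i\<close>.\<close>

lemma path_rep_meet_in_branch:
  assumes rep: "path_rep W A V E P" and e: "(q, i) \<in> E"
    and x: "x \<in> W" "q \<in> set (P x)" and w: "w \<in> W" "i \<in> set (P w)" "q \<notin> set (P w)"
  shows "A x w \<longleftrightarrow> i \<in> set (P x)"
proof -
  interpret cut_tree V E using path_repD(1)[OF rep] .
  have s: "subtree (set (P x))" "subtree (set (P w))"
    using subtree_path path_repD(2)[OF rep] x w by auto
  have b: "set (P w) \<subseteq> side E q i" using subtree_in_branch[OF s(2) e w(3,2)] by simp
  have "x \<noteq> w" using x w by blast
  then have "A x w \<longleftrightarrow> set (P x) \<inter> set (P w) \<noteq> {}" using path_repD(3)[OF rep] x w by blast
  moreover have "i \<in> set (P x)" if "z \<in> set (P x)" "z \<in> set (P w)" for z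
    using subtreeD(1)[OF s(1) E_sym[OF e] x(2) that(1)] b that(2) side_refl by blast
  ultimately show ?thesis using w by blast
qed

text \<open>The colours \<open>Some c\<close> come from the neighbours \<open>c\<close> of one
  vertex in the host tree for \<open>W - {w i0}\<close>, at most \<open>h\<close> of them;
  \<open>None\<close> is the additional colour.\<close>

lemma branch_colouring:
  fixes V :: "'t :: linorder set"
  assumes rep: "path_rep W A V E P" and red: "reduced_rep W E P" and q: "q \<in> V"
    and del: "\<And>w. w \<in> W \<Longrightarrow> \<exists>(V' :: 's set) E' P'. path_rep (W - {w}) A V' E' P' \<and>
      (\<forall>x\<in>V'. card {y. (x, y) \<in> E'} \<le> h)"
  shows "\<exists>f :: 't \<Rightarrow> 's option. card (f ` {r. (q, r) \<in> E}) \<le> h + 1 \<and>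
    (\<forall>x\<in>W. \<forall>i j. {q, i, j} \<subseteq> set (P x) \<longrightarrow> (q, i) \<in> E \<longrightarrow> (q, j) \<in> E \<longrightarrow> i \<noteq> j \<longrightarrow> f i \<noteq> f j)"
proof (cases "\<exists>i. (q, i) \<in> E")
  case False
  then show ?thesis by (intro exI[of _ "\<lambda>_. None"]) auto
next
  case True
  interpret T: cut_tree V E using path_repD(1)[OF rep] .
  define N where "N = {r. (q, r) \<in> E}"
  obtain i0 where i0: "i0 \<in> N" using True by (auto simp: N_def)
  have "\<exists>w. w \<in> W \<and> i \<in> set (P w) \<and> q \<notin> set (P w)" if "i \<in> N" for i
    using red T.E_sym[of q i] that unfolding reduced_rep_def N_def by blast
  then obtain w where w: "\<And>i. i \<in> N \<Longrightarrow> w i \<in> W" "\<And>i. i \<in> N \<Longrightarrow> i \<in> set (P (w i))"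
    "\<And>i. i \<in> N \<Longrightarrow> q \<notin> set (P (w i))" by metis
  define C where "C = {x \<in> W. q \<in> set (P x)}"
  define S where "S i = {x \<in> C. i \<in> set (P x)}" for i
  \<comment> \<open>This turns \<open>S i\<close> into the set of members of \<open>C\<close>
    adjacent to \<open>w i\<close>. Being stated by adjacency alone, it can be read off in the other
    representation as well.\<close>
  have meet: "A x (w i) \<longleftrightarrow> i \<in> set (P x)" if "x \<in> C" "i \<in> N" for x i
    using path_rep_meet_in_branch[OF rep, of q i x "w i"] w[OF that(2)] that by (auto simp: C_def N_def)
  have w_branch: "set (P (w i)) \<subseteq> side E q i" if "i \<in> N" for i
    using T.subtree_in_branch[OF T.subtree_path[OF path_repD(2)[OF rep w(1)[OF that]]], of q i i]
      w[OF that] that T.side_refl by (simp add: N_def)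
  have w_disj: "set (P (w i)) \<inter> set (P (w j)) = {}" if "i \<in> N" "j \<in> N" "i \<noteq> j" for i j
    using w_branch[OF that(1)] w_branch[OF that(2)] T.branch_unique[of q i j] that
    unfolding N_def by blast
  have w_inj: "w i \<noteq> w j" if "i \<in> N" "j \<in> N" "i \<noteq> j" for i j
    using w_disj[OF that] w(2)[OF that(1)] by auto
  have w_indep: "\<not> A (w i) (w j)" if "i \<in> N" "j \<in> N" "i \<noteq> j" for i j
    using path_repD(3)[OF rep w(1) w(1) w_inj] w_disj that by blast

  obtain V' :: "'s set" and E' P' where rep': "path_rep (W - {w i0}) A V' E' P'"
    and deg: "\<And>x. x \<in> V' \<Longrightarrow> card {y. (x, y) \<in> E'} \<le> h"
    using del[OF w(1)[OF i0]] by blast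
  interpret T': cut_tree V' E' using path_repD(1)[OF rep'] .
  have C_W': "C \<subseteq> W - {w i0}" using w(3)[OF i0] by (auto simp: C_def)
  have C_w: "x \<noteq> w i" if "x \<in> C" "i \<in> N" for x i using w(3)[OF that(2)] that(1) by (auto simp: C_def)
  have w_W': "w i \<in> W - {w i0}" if "i \<in> N - {i0}" for i using w(1) w_inj[of i i0] i0 that by blast
  have P'_sub: "T'.subtree (set (P' x))" if "x \<in> W - {w i0}" for x
    using T'.subtree_path path_repD(2)[OF rep' that] .
  have P'_ne: "set (P' x) \<noteq> {}" if "x \<in> W - {w i0}" for x
    using path_repD(2)[OF rep' that] by (simp add: tree_path_def)
  have "\<exists>q'\<in>V'. \<forall>X\<in>(\<lambda>x. set (P' x)) ` C. q' \<in> X"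
  proof (rule T'.helly)
    fix X Y assume "X \<in> (\<lambda>x. set (P' x)) ` C" "Y \<in> (\<lambda>x. set (P' x)) ` C"
    then obtain x y where xy: "x \<in> C" "y \<in> C" "X = set (P' x)" "Y = set (P' y)" by blast
    have "A x y" if "x \<noteq> y"
      using path_repD(3)[OF rep _ _ that] xy by (auto simp: C_def)
    then show "X \<inter> Y \<noteq> {}"
      using path_repD(3)[OF rep', of x y] P'_ne[of x] xy C_W' by (cases "x = y") auto
  qed (use P'_sub P'_ne C_W' in auto)
  then obtain q' where q': "q' \<in> V'" "\<And>x. x \<in> C \<Longrightarrow> q' \<in> set (P' x)" by blast
  have meet': "set (P' x) \<inter> set (P' (w i)) \<noteq> {} \<longleftrightarrow> i \<in> set (P x)" if "x \<in> C" "i \<in> N - {i0}" for x i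
    using path_repD(3)[OF rep' _ w_W' C_w] meet that C_W' by blast
  \<comment> \<open>Here the edge is used in the other orientation: some path contains
    \<open>q\<close> but not \<open>i\<close>. It belongs to \<open>C\<close>, so its counterpart
    passes through \<open>q'\<close>, yet it misses that of \<open>w i\<close>.\<close>
  have q'_w: "q' \<notin> set (P' (w i))" if i: "i \<in> N - {i0}" for i
  proof -
    obtain u where "u \<in> W" "q \<in> set (P u)" "i \<notin> set (P u)"
      using red i unfolding reduced_rep_def N_def by blast
    then have "u \<in> C" "set (P' u) \<inter> set (P' (w i)) = {}"
      using meet'[of u i] i by (auto simp: C_def)
    then show ?thesis using q' by blast
  qed
  have "\<exists>c. (q', c) \<in> E' \<and> set (P' (w i)) \<subseteq> side E' q' c" if i: "i \<in> N - {i0}" for i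
  proof -
    obtain z where z: "z \<in> set (P' (w i))" using P'_ne[OF w_W'[OF i]] by (meson ex_in_conv)
    then have "z \<in> V'" "z \<noteq> q'" using P'_sub[OF w_W'[OF i]] q'_w[OF i] by (auto simp: T'.subtree_def)
    then obtain c where c: "(q', c) \<in> E'" "z \<in> side E' q' c" using T'.branch_exists[OF q'(1)] by blast
    then show ?thesis using T'.subtree_in_branch[OF P'_sub[OF w_W'[OF i]] c(1) q'_w[OF i] z] by blast
  qed
  then obtain c where c: "\<And>i. i \<in> N - {i0} \<Longrightarrow> (q', c i) \<in> E'"
    "\<And>i. i \<in> N - {i0} \<Longrightarrow> set (P' (w i)) \<subseteq> side E' q' (c i)" by metis
  \<comment> \<open>The conflict provides \<open>x\<close>, whose new path contains
    \<open>q'\<close> and meets the disjoint paths of \<open>w i\<close> and \<open>w j\<close>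
    inside one branch. All members of \<open>C\<close> pass through \<open>q'\<close>, so blocking
    in that branch becomes inclusion between \<open>S i\<close> and \<open>S j\<close>.\<close>
  have nested: "S i \<subseteq> S j \<or> S j \<subseteq> S i"
    if i: "i \<in> N - {i0}" and j: "j \<in> N - {i0}" and ij: "i \<noteq> j" "c i = c j" and x: "x \<in> S i" "x \<in> S j"
    for i j x
  proof -
    let ?X = "set (P' (w i))" and ?Y = "set (P' (w j))"
    have xC: "x \<in> C" using x by (simp add: S_def)
    have d: "?X \<inter> ?Y = {}"
    proof -
      have "i \<in> N" "j \<in> N" using i j by auto
      then show ?thesis
        using path_repD(3)[OF rep' w_W'[OF i] w_W'[OF j] w_inj[of i j]] w_indep[of i j] ij(1) by simp
    qed
    have n: "set (P' x) \<inter> ?X \<noteq> {}" "set (P' x) \<inter> ?Y \<noteq> {}"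
      using iffD2[OF meet'[OF xC i]] iffD2[OF meet'[OF xC j]] x unfolding S_def by simp_all
    have "(\<forall>U. T'.subtree U \<longrightarrow> q' \<in> U \<longrightarrow> U \<inter> ?Y \<noteq> {} \<longrightarrow> U \<inter> ?X \<noteq> {}) \<or>
          (\<forall>U. T'.subtree U \<longrightarrow> q' \<in> U \<longrightarrow> U \<inter> ?X \<noteq> {} \<longrightarrow> U \<inter> ?Y \<noteq> {})"
    proof (rule T'.nested_in_branch[OF _ q'(2)[OF xC] c(1)[OF i] _ c(2)[OF i] n(1) _ _ n(2) d])
      show "tree_path V' E' (P' x)" using path_repD(2)[OF rep'] xC C_W' by blast
      show "T'.subtree ?X" "T'.subtree ?Y" using P'_sub w_W' i j by auto
      show "?Y \<subseteq> side E' q' (c i)" using c(2)[OF j] ij by simp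
    qed
    moreover have "T'.subtree (set (P' u))" "q' \<in> set (P' u)"
      "set (P' u) \<inter> ?X \<noteq> {} \<longleftrightarrow> i \<in> set (P u)" "set (P' u) \<inter> ?Y \<noteq> {} \<longleftrightarrow> j \<in> set (P u)"
      if "u \<in> C" for u
      by (rule P'_sub[OF subsetD[OF C_W' that]] q'(2)[OF that] meet'[OF that i] meet'[OF that j])+
    ultimately have "(\<forall>u\<in>C. j \<in> set (P u) \<longrightarrow> i \<in> set (P u)) \<or> (\<forall>u\<in>C. i \<in> set (P u) \<longrightarrow> j \<in> set (P u))"
      by meson
    then show ?thesis unfolding S_def by blast
  qed

  have three: "k = i \<or> k = j"
    if "y \<in> S i" "y \<in> S j" "y \<in> S k" "i \<in> N" "j \<in> N" "k \<in> N" "i \<noteq> j" for i j k y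
  proof -
    have y: "y \<in> W" "q \<in> set (P y)" "{i, j, k} \<subseteq> set (P y)" using that(1-3) by (auto simp: S_def C_def)
    have e: "(q, i) \<in> E" "(q, j) \<in> E" "(q, k) \<in> E" using that(4-6) by (auto simp: N_def)
    show ?thesis using T.path_two_neighbours[OF path_repD(2)[OF rep y(1)] y(2,3) e] that(7) by blast
  qed
  \<comment> \<open>Inclusion with ties broken by the linear order, so that exactly one direction
    holds between two distinct nested neighbours. This selects one neighbour from each pair with
    \<open>S i = S j\<close>.\<close>
  define D where "D i j \<longleftrightarrow> S i \<subseteq> S j \<and> (S i \<noteq> S j \<or> i < j)" for i j
  define L where "L = {i \<in> N - {i0}. \<exists>j \<in> N - {i0}. j \<noteq> i \<and> S i \<noteq> {} \<and> D i j}"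
  \<comment> \<open>A path through \<open>q\<close> and \<open>i\<close> also contains the
    dominating \<open>j\<close> and has no room for a third neighbour of \<open>q\<close>, so
    \<open>i\<close> conflicts with \<open>j\<close> only. Hence \<open>i\<close> has no conflict
    with \<open>i0\<close>, and two conflicting members of \<open>L\<close> would dominate each
    other.\<close>
  have L_nbr: "k \<noteq> i0 \<and> D i k" if "i \<in> L" "k \<in> N" "k \<noteq> i" "y \<in> S i" "y \<in> S k" for i k y
  proof -
    obtain j where j: "j \<in> N - {i0}" "j \<noteq> i" "D i j" using \<open>i \<in> L\<close> by (auto simp: L_def)
    then have "y \<in> S j" using that(4) unfolding D_def by blast
    moreover have "i \<in> N" using that(1) by (simp add: L_def)
    ultimately have "k = j" using three[of y i j k] that(2-5) j(1,2) by blast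
    then show ?thesis using j by blast
  qed
  have D_asym: "\<not> (D i j \<and> D j i)" for i j
    using less_asym[of i j] subset_antisym[of "S i" "S j"] unfolding D_def by argo
  have D_total: "D i j \<or> D j i" if "S i \<subseteq> S j \<or> S j \<subseteq> S i" "i \<noteq> j" for i j
    using that less_linear[of i j] unfolding D_def by metis
  define f where "f i = (if i = i0 \<or> i \<in> L then None else Some (c i))" for i
  have "f i \<noteq> f j" if x: "x \<in> W" "{q, i, j} \<subseteq> set (P x)" and ij: "i \<in> N" "j \<in> N" "i \<noteq> j" for x i j
  proof
    assume eq: "f i = f j"
    have xS: "x \<in> S i" "x \<in> S j" using x by (auto simp: S_def C_def)
    show False
    proof (cases "i = i0 \<or> i \<in> L")
      case True
      then have "j = i0 \<or> j \<in> L" using eq by (auto simp: f_def split: if_splits)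
      moreover have "j \<noteq> i0 \<and> D i j" if "i \<in> L" using L_nbr[OF that ij(2)] ij(3) xS by simp
      moreover have "i \<noteq> i0 \<and> D j i" if "j \<in> L" using L_nbr[OF that ij(1)] ij(3) xS by simp
      ultimately show False using True D_asym[of i j] ij(3) by blast
    next
      case False
      then have j: "j \<noteq> i0" "j \<notin> L" "c i = c j" using eq by (auto simp: f_def split: if_splits)
      \<comment> \<open>Equal colours other than \<open>None\<close> mean the same branch at
        \<open>q'\<close>, so the two are nested and the dominated one would have been put into
        \<open>L\<close>.\<close>
      have "D i j \<or> D j i" using D_total[OF nested[of i j x]] False j ij xS by blast
      moreover have "S i \<noteq> {}" "S j \<noteq> {}" using xS by auto
      ultimately have "i \<in> L \<or> j \<in> L" using False j(1) ij unfolding L_def by auto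
      then show False using False j(2) by blast
    qed
  qed
  moreover have "card (f ` N) \<le> h + 1"
  proof -
    let ?M = "{y. (q', y) \<in> E'}"
    have "f ` N \<subseteq> insert None (Some ` ?M)" using c(1) by (auto simp: f_def)
    then have "card (f ` N) \<le> card (insert None (Some ` ?M))"
      by (rule card_mono[rotated]) (simp add: T'.finite_neighbours)
    also have "\<dots> \<le> Suc (card ?M)"
      by (simp add: card_insert_if card_image T'.finite_neighbours)
    finally show ?thesis using deg[OF q'(1)] by simp
  qed
  ultimately show ?thesis unfolding N_def by (intro exI[of _ f]) simp
qed

section \<open>Expanding the vertices of a tree into spiders\<close>

text \<open>Every vertex \<open>q\<close> becomes a spider with centre \<open>(q, q)\<close> and one leg per colour; the leg of
  colour \<open>c\<close> consists of the nodes \<open>(q, r)\<close>, one for each neighbour \<open>r\<close> of \<open>q\<close> with \<open>f q r = c\<close>,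
  in increasing order of \<open>r\<close>.  The old edge between \<open>q\<close> and \<open>r\<close> joins \<open>(q, r)\<close> to \<open>(r, q)\<close>.\<close>

locale coloured_tree = cut_tree V E
  for V :: "'t :: linorder set" and E +
  fixes f :: "'t \<Rightarrow> 't \<Rightarrow> 'c"
begin

definition below :: "'t \<Rightarrow> 't \<Rightarrow> 't set" where
  "below q b = {r. (q, r) \<in> E \<and> f q r = f q b \<and> r < b}"

text \<open>The second coordinate of the node just before \<open>(q, b)\<close> on its leg. The
  value \<open>q\<close> stands for the centre and is never confused with a leg node, because
  \<open>E\<close> has no loops.\<close>

definition inner :: "'t \<Rightarrow> 't \<Rightarrow> 't" where
  "inner q b = (if below q b = {} then q else Max (below q b))"

text \<open>The leg nodes are the arcs of the old tree themselves.\<close>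

definition SV :: "('t \<times> 't) set" where
  "SV = (\<lambda>q. (q, q)) ` V \<union> E"

inductive_set SE :: "('t \<times> 't) rel" where
  cross: "(q, r) \<in> E \<Longrightarrow> ((q, r), (r, q)) \<in> SE"
| outward: "(q, b) \<in> E \<Longrightarrow> ((q, inner q b), (q, b)) \<in> SE"
| inward: "(q, b) \<in> E \<Longrightarrow> ((q, b), (q, inner q b)) \<in> SE"

lemma SE_cases [consumes 1, case_names cross outward inward]:
  assumes "(x, y) \<in> SE"
  obtains q r where "x = (q, r)" "y = (r, q)" "(q, r) \<in> E"
  | q b where "x = (q, inner q b)" "y = (q, b)" "(q, b) \<in> E"
  | q b where "x = (q, b)" "y = (q, inner q b)" "(q, b) \<in> E"
  using assms by (cases x; cases y) (auto elim: SE.cases)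

lemma finite_below: "finite (below q b)"
  by (rule finite_subset[OF _ finite_neighbours[of q]]) (auto simp: below_def)

lemma inner_cases:
  obtains "below q b = {}" "inner q b = q"
  | "(q, inner q b) \<in> E" "f q (inner q b) = f q b" "inner q b < b"
proof (cases "below q b = {}")
  case True
  then show ?thesis using that(1) by (simp add: inner_def)
next
  case False
  then have "inner q b \<in> below q b" using Max_in finite_below by (simp add: inner_def)
  then show ?thesis using that(2) unfolding below_def by blast
qed

lemma inner_ge:
  assumes "(q, r) \<in> E" "f q r = f q b" "r < b"
  shows "inner q b \<noteq> q" "r \<le> inner q b"
proof -
  have r: "r \<in> below q b" using assms by (simp add: below_def)
  then have "below q b \<noteq> {}" by blast
  then have "inner q b = Max (below q b)" by (simp add: inner_def)
  then show le: "r \<le> inner q b" using Max_ge[OF finite_below r] by simp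
  show "inner q b \<noteq> q"
    using \<open>below q b \<noteq> {}\<close> E_irrefl[of q] by (cases rule: inner_cases[of q b]) auto
qed

lemma SE_sym: "(x, y) \<in> SE \<Longrightarrow> (y, x) \<in> SE"
  by (erule SE_cases) (simp_all add: SE.outward SE.inward SE.cross[OF E_sym])

lemma SE_SV: "SE \<subseteq> SV \<times> SV"
proof -
  have i: "(q, inner q b) \<in> SV" if "(q, b) \<in> E" for q b
    using E_V(1)[OF that] by (cases rule: inner_cases[of q b]) (auto simp: SV_def)
  have "x \<in> SV \<and> y \<in> SV" if "(x, y) \<in> SE" for x y
    using that
  proof (cases rule: SE_cases)
    case (cross q r)
    then show ?thesis using E_sym[of q r] by (simp add: SV_def)
  qed (use i in \<open>auto simp: SV_def\<close>)
  then show ?thesis by auto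
qed

text \<open>Going from \<open>b\<close> to \<open>inner q b\<close> lowers the number of smaller
  neighbours of the same colour. The list omits the centre, and the bound on \<open>set s\<close>
  records that it stays on one leg, which later keeps legs of different colours apart.\<close>

lemma spine_exists:
  assumes "(q, b) \<in> E"
  shows "\<exists>s. s \<noteq> [] \<and> last s = (q, b) \<and> distinct s \<and>
    set s \<subseteq> {(q, r) | r. (q, r) \<in> E \<and> f q r = f q b \<and> r \<le> b} \<and>
    successively (\<lambda>x y. (x, y) \<in> SE) ((q, q) # s)"
  using assms
proof (induction "card (below q b)" arbitrary: b rule: less_induct)
  case less
  show ?case
  proof (cases rule: inner_cases[of q b])
    case 1
    then show ?thesis using outward[OF less.prems] less.prems by (intro exI[of _ "[(q, b)]"]) auto
  next
    case 2
    have "below q (inner q b) \<subset> below q b"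
      using 2 by (auto simp: below_def)
    then have "card (below q (inner q b)) < card (below q b)"
      using psubset_card_mono[OF finite_below] by blast
    then obtain s where s: "s \<noteq> []" "last s = (q, inner q b)" "distinct s"
      "set s \<subseteq> {(q, r) | r. (q, r) \<in> E \<and> f q r = f q (inner q b) \<and> r \<le> inner q b}"
      "successively (\<lambda>x y. (x, y) \<in> SE) ((q, q) # s)"
      using less.hyps 2 by blast
    have "(q, b) \<notin> set s" using s(4) 2 by auto
    moreover have "successively (\<lambda>x y. (x, y) \<in> SE) (((q, q) # s) @ [(q, b)])"
      using s(1,2,5) outward[OF less.prems] by (subst successively_append_iff) auto
    moreover have "set s \<subseteq> {(q, r) | r. (q, r) \<in> E \<and> f q r = f q b \<and> r \<le> b}"
      using s(4) 2 by auto
    ultimately show ?thesis using s(1,3) less.prems by (intro exI[of _ "s @ [(q, b)]"]) auto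
  qed
qed

text \<open>An edge between two spiders inherits the cut of the old edge. A leg edge is cut off by
  the outer part of its leg together with all branches attached there; for the opposite orientation
  the complement is taken.\<close>

lemma spider_tree: "cut_tree SV SE"
proof
  show "finite SV"
    unfolding SV_def using finite_V E_subset by (meson finite_SigmaI finite_UnI finite_imageI finite_subset)
  show "SV \<noteq> {}" using V_nonempty by (simp add: SV_def)
  show "SE \<subseteq> SV \<times> SV" by (rule SE_SV)
  show "(y, x) \<in> SE" if "(x, y) \<in> SE" for x y using SE_sym that .
  have rev: "(y, x) \<in> SE\<^sup>*" if "(x, y) \<in> SE\<^sup>*" for x y
    using that SE_sym by (metis sym_def sym_rtrancl)
  have leg: "((q, q), (q, b)) \<in> SE\<^sup>*" if qb: "(q, b) \<in> E" for q b
  proof -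
    obtain s where s: "s \<noteq> []" "last s = (q, b)" "successively (\<lambda>x y. (x, y) \<in> SE) ((q, q) # s)"
      using spine_exists[OF qb] by blast
    then have "(q, b) \<in> set ((q, q) # s)" by (metis last_in_set list.set_intros(2))
    then show ?thesis using successively_rtrancl[OF s(3)] by blast
  qed
  have centres: "((p, p), (q, q)) \<in> SE\<^sup>*" if "(p, q) \<in> E\<^sup>*" for p q
    using that
  proof induction
    case (step q r)
    have "((q, q), (q, r)) \<in> SE\<^sup>*" "((q, r), (r, q)) \<in> SE\<^sup>*" "((r, q), (r, r)) \<in> SE\<^sup>*"
      using leg[OF step(2)] cross[OF step(2)] rev[OF leg[OF E_sym[OF step(2)]]] by auto
    then show ?case using step.IH by (meson rtrancl_trans)
  qed simp
  have to_centre: "((fst x, fst x), x) \<in> SE\<^sup>*" "fst x \<in> V" if "x \<in> SV" for x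
  proof -
    consider "fst x \<in> V" "x = (fst x, fst x)" | "(fst x, snd x) \<in> E"
      using \<open>x \<in> SV\<close> by (auto simp: SV_def)
    then show "((fst x, fst x), x) \<in> SE\<^sup>*" "fst x \<in> V"
      using leg[of "fst x" "snd x"] E_V(1)[of "fst x" "snd x"] by (cases; simp)+
  qed
  show "(x, y) \<in> SE\<^sup>*" if "x \<in> SV" "y \<in> SV" for x y
    using rev[OF to_centre(1)[OF that(1)]] centres[OF E_conn[OF to_centre(2)[OF that(1)] to_centre(2)[OF that(2)]]]
      to_centre(1)[OF that(2)] by (meson rtrancl_trans)
  define cut where "cut x y S \<longleftrightarrow> x \<in> S \<and> y \<notin> S \<and>
    (\<forall>a b. (a, b) \<in> SE \<longrightarrow> a \<in> S \<longrightarrow> b \<notin> S \<longrightarrow> a = x \<and> b = y)" for x y S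
  have cut_rev: "cut y x (- S)" if "cut x y S" for x y S
    using that SE_sym unfolding cut_def by blast
  have cut_cross: "\<exists>S. cut (q, r) (r, q) S" if qr: "(q, r) \<in> E" for q r
  proof -
    obtain S where S: "q \<in> S" "r \<notin> S" "\<And>a b. (a, b) \<in> E \<Longrightarrow> a \<in> S \<Longrightarrow> b \<notin> S \<Longrightarrow> a = q \<and> b = r"
      using E_cut[OF qr] by blast
    have "a = (q, r) \<and> b = (r, q)" if "(a, b) \<in> SE" "fst a \<in> S" "fst b \<notin> S" for a b
      using that(1)
    proof (cases rule: SE_cases)
      case (cross u v)
      then show ?thesis using S(3)[of u v] that(2,3) by simp
    qed (use that in auto)
    then show ?thesis using S(1,2) by (intro exI[of _ "{x. fst x \<in> S}"]) (simp add: cut_def)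
  qed
  have cut_leg: "\<exists>S. cut (q, b) (q, inner q b) S" if qb: "(q, b) \<in> E" for q b
  proof -
    \<comment> \<open>\<open>br x\<close> is the node of the spider at \<open>q\<close> to which
      \<open>x\<close> belongs or is attached: its own second coordinate, or else the branch at
      \<open>q\<close> containing the vertex of \<open>x\<close>. The choice is unique by
      \<open>branch_unique\<close>. \<open>U\<close> collects the nodes of the leg from
      \<open>b\<close> outwards.\<close>
    define br where "br x = (if fst x = q then snd x else SOME p. (q, p) \<in> E \<and> fst x \<in> side E q p)" for x
    define U where "U = {r. (q, r) \<in> E \<and> f q r = f q b \<and> b \<le> r}"
    have br: "br x = p" if "fst x \<noteq> q" "(q, p) \<in> E" "fst x \<in> side E q p" for x p
    proof -
      have "(SOME p. (q, p) \<in> E \<and> fst x \<in> side E q p) = p"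
        by (rule some_equality) (use that branch_unique in blast)+
      then show ?thesis using that(1) by (simp add: br_def)
    qed
    have br_cross: "br (u, v) = br (v, u)" if uv: "(u, v) \<in> E" for u v
    proof -
      have ne: "u \<noteq> v" using uv E_irrefl by blast
      consider "u = q" | "v = q" | "u \<noteq> q" "v \<noteq> q" by blast
      then show ?thesis
      proof cases
        case 1
        then show ?thesis using br[of "(v, u)" v] uv ne by (simp add: br_def)
      next
        case 2
        then show ?thesis using br[of "(u, v)" u] E_sym[OF uv] ne by (simp add: br_def)
      next
        case 3
        have "q \<in> V" using qb E_V by blast
        then obtain p where p: "(q, p) \<in> E" "u \<in> side E q p"
          using branch_exists[of q u] 3 E_V(1)[OF uv] by blast
        then have "v \<in> side E q p" using side_leave'[OF p uv] 3 by blast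
        then show ?thesis using br[of "(u, v)" p] br[of "(v, u)" p] p 3 by simp
      qed
    qed
    have U_up: "c \<in> U" if "(q, c) \<in> E" "inner q c \<in> U" for c
      using that E_irrefl[of q] by (cases rule: inner_cases[of q c]) (auto simp: U_def)
    have U_low: "c = b" if "c \<in> U" "inner q c \<notin> U" for c
    proof (rule ccontr)
      assume "c \<noteq> b"
      then have bc: "f q b = f q c" "b < c" using that(1) by (auto simp: U_def)
      have "inner q c \<noteq> q" "b \<le> inner q c" using inner_ge[OF qb bc] by auto
      then show False using that(2) bc by (cases rule: inner_cases[of q c]) (auto simp: U_def)
    qed
    have bU: "b \<in> U" using qb by (simp add: U_def)
    have iU: "inner q b \<notin> U" using E_irrefl[of q] by (cases rule: inner_cases[of q b]) (auto simp: U_def)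
    have "x = (q, b) \<and> y = (q, inner q b)" if "(x, y) \<in> SE" "br x \<in> U" "br y \<notin> U" for x y
      using that(1)
    proof (cases rule: SE_cases)
      case (cross u v)
      then show ?thesis using br_cross[of u v] that(2,3) by simp
    next
      case (outward u c)
      then have "u = q" using that(2,3) by (cases "u = q") (simp_all add: br_def)
      then show ?thesis using outward U_up[of c] that(2,3) by (simp add: br_def)
    next
      case (inward u c)
      then have "u = q" using that(2,3) by (cases "u = q") (simp_all add: br_def)
      then show ?thesis using inward U_low[of c] that(2,3) by (simp add: br_def)
    qed
    moreover have "br (q, b) \<in> U" "br (q, inner q b) \<notin> U" using bU iU by (simp_all add: br_def)
    ultimately show ?thesis by (intro exI[of _ "{x. br x \<in> U}"]) (simp add: cut_def)
  qed
  fix x y assume "(x, y) \<in> SE"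
  then have "\<exists>S. cut x y S"
  proof (cases rule: SE_cases)
    case (cross q r)
    then show ?thesis using cut_cross by simp
  next
    case (outward q b)
    then show ?thesis using cut_leg cut_rev by blast
  next
    case (inward q b)
    then show ?thesis using cut_leg by simp
  qed
  then show "\<exists>S. x \<in> S \<and> y \<notin> S \<and> (\<forall>a b. (a, b) \<in> SE \<longrightarrow> a \<in> S \<longrightarrow> b \<notin> S \<longrightarrow> a = x \<and> b = y)"
    unfolding cut_def .
qed

text \<open>The centre is joined to the first node of each leg, one per colour. A leg node has one
  neighbour across the old edge and at most two along the leg, which is where
  \<open>3 \<le> k\<close> enters.\<close>

lemma spider_degree:
  assumes x: "x \<in> SV" and k: "3 \<le> k" and col: "\<And>q. q \<in> V \<Longrightarrow> card (f q ` {r. (q, r) \<in> E}) \<le> k"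
  shows "card {y. (x, y) \<in> SE} \<le> k"
proof -
  \<comment> \<open>Within one colour \<open>inner q\<close> is injective, so each leg has one first
    node and each leg node has at most one outward successor.\<close>
  have same: "c = c'" if "(q, c) \<in> E" "(q, c') \<in> E" "f q c = f q c'" "inner q c = inner q c'" for q c c'
  proof -
    have "\<not> c < c'" if a: "(q, c) \<in> E" "(q, c') \<in> E" "f q c = f q c'" "inner q c = inner q c'" for c c'
    proof
      assume "c < c'"
      from inner_ge[OF a(1,3) this] a(4) have "inner q c \<noteq> q" "c \<le> inner q c" by auto
      then show False by (cases rule: inner_cases[of q c]) auto
    qed
    from this[of c c'] this[of c' c] show ?thesis using that by (metis neq_iff)
  qed
  consider q where "q \<in> V" "x = (q, q)" | q b where "(q, b) \<in> E" "x = (q, b)"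
    using x by (cases x) (auto simp: SV_def)
  then show ?thesis
  proof cases
    case 1
    let ?M = "{c. (q, c) \<in> E \<and> inner q c = q}"
    have fin: "finite ?M" by (rule finite_subset[OF _ finite_neighbours[of q]]) auto
    have "{y. (x, y) \<in> SE} \<subseteq> Pair q ` ?M"
    proof
      fix y assume "y \<in> {y. (x, y) \<in> SE}"
      then have "(x, y) \<in> SE" by simp
      then show "y \<in> Pair q ` ?M" by (cases rule: SE_cases) (use 1 E_irrefl in auto)
    qed
    then have "card {y. (x, y) \<in> SE} \<le> card (Pair q ` ?M)" using fin by (intro card_mono) auto
    also have "\<dots> \<le> card ?M" by (rule card_image_le[OF fin])
    also have "\<dots> = card (f q ` ?M)"
      by (rule card_image[symmetric], rule inj_onI, rule same[of q]) auto
    also have "\<dots> \<le> card (f q ` {r. (q, r) \<in> E})"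
      using finite_neighbours by (intro card_mono) auto
    also have "\<dots> \<le> k" using col 1 by blast
    finally show ?thesis .
  next
    case 2
    have bq: "b \<noteq> q" using 2 E_irrefl by blast
    \<comment> \<open>\<open>c0\<close> is the only candidate for the next node outwards, and is
      arbitrary if \<open>b\<close> ends its leg.\<close>
    have "\<exists>c0. \<forall>c. (q, c) \<in> E \<and> inner q c = b \<longrightarrow> c = c0"
    proof -
      have "c = c'" if "(q, c) \<in> E" "inner q c = b" "(q, c') \<in> E" "inner q c' = b" for c c'
      proof -
        have "f q d = f q b" if "inner q d = b" for d
          using that bq by (cases rule: inner_cases[of q d]) auto
        then show ?thesis using same[of q c c'] that by simp
      qed
      then show ?thesis by blast
    qed
    then obtain c0 where c0: "\<And>c. (q, c) \<in> E \<Longrightarrow> inner q c = b \<Longrightarrow> c = c0" by blast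
    have "{y. (x, y) \<in> SE} \<subseteq> {(b, q), (q, inner q b), (q, c0)}"
    proof
      fix y assume "y \<in> {y. (x, y) \<in> SE}"
      then have "(x, y) \<in> SE" by simp
      then show "y \<in> {(b, q), (q, inner q b), (q, c0)}" by (cases rule: SE_cases) (use 2 c0 in auto)
    qed
    then have "card {y. (x, y) \<in> SE} \<le> card {(b, q), (q, inner q b), (q, c0)}"
      by (intro card_mono) auto
    also have "\<dots> \<le> 3" by (auto simp: card_insert_if)
    finally show ?thesis using k by simp
  qed
qed

text \<open>The new path visits the centres in the old order: out along the leg of \<open>v\<close>
  to \<open>(v, w)\<close>, across to \<open>(w, v)\<close>, and in to \<open>(w, w)\<close>. The
  last conjunct strengthens the induction: at its first vertex the new path uses only the leg
  leading to the second vertex.\<close>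

lemma spider_path:
  assumes "tree_path V E p"
    and "\<And>q i j. {q, i, j} \<subseteq> set p \<Longrightarrow> (q, i) \<in> E \<Longrightarrow> (q, j) \<in> E \<Longrightarrow> i \<noteq> j \<Longrightarrow> f q i \<noteq> f q j"
  shows "\<exists>p'. tree_path SV SE p' \<and> hd p' = (hd p, hd p) \<and>
    (\<lambda>v. (v, v)) ` set p \<subseteq> set p' \<and> fst ` set p' \<subseteq> set p \<and>
    (\<forall>r. (hd p, r) \<in> set p' \<longrightarrow> r = hd p \<or> tl p \<noteq> [] \<and> f (hd p) r = f (hd p) (hd (tl p)))"
  using assms
proof (induction p rule: induct_list012)
  case 1
  then show ?case by (simp add: tree_path_def)
next
  case (2 v)
  then show ?case by (intro exI[of _ "[(v, v)]"]) (auto simp: tree_path_def SV_def)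
next
  case (3 v w ps)
  have vw: "(v, w) \<in> E" "v \<noteq> w" "v \<notin> set (w # ps)" "v \<in> V" and tp: "tree_path V E (w # ps)"
    using 3(3) by (auto simp: tree_path_def)
  obtain p' where p': "tree_path SV SE p'" "hd p' = (w, w)"
    "(\<lambda>v. (v, v)) ` set (w # ps) \<subseteq> set p'" "fst ` set p' \<subseteq> set (w # ps)"
    "\<And>r. (w, r) \<in> set p' \<Longrightarrow> r = w \<or> ps \<noteq> [] \<and> f w r = f w (hd ps)"
  proof -
    have "f q i \<noteq> f q j" if "{q, i, j} \<subseteq> set (w # ps)" "(q, i) \<in> E" "(q, j) \<in> E" "i \<noteq> j" for q i j
      by (rule 3(4)[OF _ that(2-4)]) (use that(1) in auto)
    from 3(2)[OF tp this] show ?thesis using that by auto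
  qed
  obtain s where s: "s \<noteq> []" "last s = (v, w)" "distinct s"
    "set s \<subseteq> {(v, r) | r. (v, r) \<in> E \<and> f v r = f v w \<and> r \<le> w}"
    "successively (\<lambda>x y. (x, y) \<in> SE) ((v, v) # s)" using spine_exists[OF vw(1)] by blast
  obtain t where t: "t \<noteq> []" "last t = (w, v)" "distinct t"
    "set t \<subseteq> {(w, r) | r. (w, r) \<in> E \<and> f w r = f w v \<and> r \<le> v}"
    "successively (\<lambda>x y. (x, y) \<in> SE) ((w, w) # t)" using spine_exists[OF E_sym[OF vw(1)]] by blast
  have p'_ne: "p' \<noteq> []" and p'_dist: "distinct p'" and p'_V: "set p' \<subseteq> SV"
    and p'_succ: "successively (\<lambda>x y. (x, y) \<in> SE) p'"
    using p'(1) by (auto simp: tree_path_def)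
  have st: "fst ` set s \<subseteq> {v}" "fst ` set t \<subseteq> {w}" using s(4) t(4) by auto
  \<comment> \<open>Both lists may use nodes of the spider at \<open>w\<close>, but on different
    legs: the old path passes \<open>v\<close>, \<open>w\<close> and \<open>hd ps\<close>, so
    \<open>v\<close> and \<open>hd ps\<close> have different colours at \<open>w\<close>.\<close>
  have "set t \<inter> set p' = {}"
  proof -
    have False if z: "z \<in> set t" "z \<in> set p'" for z
    proof -
      obtain r where r: "z = (w, r)" "(w, r) \<in> E" "f w r = f w v" using z(1) t(4) by blast
      have "r \<noteq> w" using r(2) E_irrefl by blast
      then have n: "ps \<noteq> []" "f w v = f w (hd ps)" using p'(5)[of r] z(2) r by auto
      have "hd ps \<in> set ps" "(w, hd ps) \<in> E"
        using n(1) tp by (auto simp: tree_path_def successively_Cons)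
      moreover have "v \<noteq> hd ps" using vw(3) calculation(1) by auto
      ultimately show False using 3(4)[of w v "hd ps"] E_sym[OF vw(1)] n(2) by simp
    qed
    then show ?thesis by blast
  qed
  moreover have "set s \<inter> set t = {}" "set s \<inter> set p' = {}" "(v, v) \<notin> set t" "(v, v) \<notin> set p'"
    using st vw(2,3) p'(4) by fastforce+
  moreover have "(v, v) \<notin> set s" using s(4) E_irrefl[of v] by auto
  ultimately have dist: "distinct (((v, v) # s) @ rev t @ p')"
    using s(3) t(3) p'_dist by auto
  have "successively (\<lambda>x y. (x, y) \<in> SE) (rev t @ p')"
  proof -
    have t5: "successively (\<lambda>x y. (x, y) \<in> SE) t" "((w, w), hd t) \<in> SE"
      using t(1,5) by (auto simp: successively_Cons)
    have "successively (\<lambda>x y. (x, y) \<in> SE) (rev t)"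
      unfolding successively_rev by (rule successively_mono[OF t5(1)]) (rule SE_sym)
    then show ?thesis
      using SE_sym[OF t5(2)] p'_succ p'(2) t(1) p'_ne
      by (simp add: successively_append_iff last_rev)
  qed
  then have "successively (\<lambda>x y. (x, y) \<in> SE) (((v, v) # s) @ rev t @ p')"
    using s(1,2,5) t(1,2) cross[OF vw(1)]
    by (subst successively_append_iff) (simp add: hd_append hd_rev)
  moreover have "set (((v, v) # s) @ rev t @ p') \<subseteq> SV"
    using s(4) t(4) p'_V vw(4) by (auto simp: SV_def)
  ultimately have "tree_path SV SE (((v, v) # s) @ rev t @ p')"
    using dist by (simp add: tree_path_def)
  moreover have "(\<lambda>v. (v, v)) ` set (v # w # ps) \<subseteq> set (((v, v) # s) @ rev t @ p')"
    using p'(3) by auto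
  moreover have "fst ` set (((v, v) # s) @ rev t @ p') \<subseteq> set (v # w # ps)"
    using p'(4) st by auto
  moreover have "r = v \<or> f v r = f v w" if "(v, r) \<in> set (((v, v) # s) @ rev t @ p')" for r
  proof -
    have "(v, r) \<notin> set t" "(v, r) \<notin> set p'" using st(2) vw(2,3) p'(4) by fastforce+
    then have "r = v \<or> (v, r) \<in> set s" using that by auto
    then show ?thesis using s(4) by auto
  qed
  ultimately show ?case by (intro exI[of _ "((v, v) # s) @ rev t @ p'"]) simp
qed

end

text \<open>Intersections are preserved because a common vertex gives a common centre, and a common
  node projects by \<open>fst\<close> to a common vertex.\<close>

lemma expand_rep:
  fixes V :: "'t :: linorder set" and f :: "'t \<Rightarrow> 't \<Rightarrow> 'c"
  assumes rep: "path_rep W A V E P"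
    and proper: "\<And>x q i j. x \<in> W \<Longrightarrow> {q, i, j} \<subseteq> set (P x) \<Longrightarrow> (q, i) \<in> E \<Longrightarrow> (q, j) \<in> E \<Longrightarrow> i \<noteq> j \<Longrightarrow>
      f q i \<noteq> f q j"
    and few: "\<And>q. q \<in> V \<Longrightarrow> card (f q ` {r. (q, r) \<in> E}) \<le> k" and k: "3 \<le> k"
  shows "\<exists>(V' :: ('t \<times> 't) set) E' P'. path_rep W A V' E' P' \<and> (\<forall>x\<in>V'. card {y. (x, y) \<in> E'} \<le> k)"
proof -
  interpret cut_tree V E using path_repD(1)[OF rep] .
  interpret coloured_tree V E f ..
  have "\<exists>p'. tree_path SV SE p' \<and> (\<lambda>v. (v, v)) ` set (P x) \<subseteq> set p' \<and> fst ` set p' \<subseteq> set (P x)"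
    if x: "x \<in> W" for x
  proof -
    have "\<exists>p'. tree_path SV SE p' \<and> hd p' = (hd (P x), hd (P x)) \<and>
      (\<lambda>v. (v, v)) ` set (P x) \<subseteq> set p' \<and> fst ` set p' \<subseteq> set (P x) \<and>
      (\<forall>r. (hd (P x), r) \<in> set p' \<longrightarrow>
        r = hd (P x) \<or> tl (P x) \<noteq> [] \<and> f (hd (P x)) r = f (hd (P x)) (hd (tl (P x))))"
      by (rule spider_path[OF path_repD(2)[OF rep x]]) (rule proper[OF x])
    then show ?thesis by (elim exE conjE) (intro exI conjI; assumption)
  qed
  then have "\<exists>P'. \<forall>x\<in>W. tree_path SV SE (P' x) \<and>
      (\<lambda>v. (v, v)) ` set (P x) \<subseteq> set (P' x) \<and> fst ` set (P' x) \<subseteq> set (P x)"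
    by (intro bchoice ballI)
  then obtain P' where "\<forall>x\<in>W. tree_path SV SE (P' x) \<and>
      (\<lambda>v. (v, v)) ` set (P x) \<subseteq> set (P' x) \<and> fst ` set (P' x) \<subseteq> set (P x)" ..
  then have P': "tree_path SV SE (P' x)" "(\<lambda>v. (v, v)) ` set (P x) \<subseteq> set (P' x)"
    "fst ` set (P' x) \<subseteq> set (P x)" if "x \<in> W" for x
    using that by simp_all
  have "set (P' x) \<inter> set (P' y) \<noteq> {} \<longleftrightarrow> set (P x) \<inter> set (P y) \<noteq> {}" if "x \<in> W" "y \<in> W" for x y
  proof
    assume "set (P' x) \<inter> set (P' y) \<noteq> {}"
    then obtain z where "z \<in> set (P' x)" "z \<in> set (P' y)" by auto
    then have "fst z \<in> set (P x)" "fst z \<in> set (P y)" using P'(3) that by auto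
    then show "set (P x) \<inter> set (P y) \<noteq> {}" by auto
  next
    assume "set (P x) \<inter> set (P y) \<noteq> {}"
    then obtain v where "v \<in> set (P x)" "v \<in> set (P y)" by auto
    then have "(v, v) \<in> set (P' x)" "(v, v) \<in> set (P' y)" using P'(2) that by auto
    then show "set (P' x) \<inter> set (P' y) \<noteq> {}" by auto
  qed
  then have "path_rep W A SV SE P'"
    using path_repD(3)[OF rep] P'(1) spider_tree unfolding path_rep_def by simp
  moreover have "card {y. (x, y) \<in> SE} \<le> k" if "x \<in> SV" for x
    by (rule spider_degree[OF that k few])
  ultimately show ?thesis by blast
qed

section \<open>Cut trees and undirected trees\<close>

lemma vwalk_arcs_successively:
  "set (vwalk_arcs p) \<subseteq> R \<longleftrightarrow> successively (\<lambda>a b. (a, b) \<in> R) p"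
  by (induction p rule: vwalk_arcs.induct) auto

lemma vpath_with_proj: "vpath p (with_proj T) \<longleftrightarrow> tree_path (pverts T) (parcs T) p"
  unfolding vpath_def vwalk_def tree_path_def by (auto simp: vwalk_arcs_successively)

lemma vwalk_arcs_memD: "(a, b) \<in> set (vwalk_arcs p) \<Longrightarrow> a \<in> set p \<and> b \<in> set (tl p)"
  by (induction p rule: vwalk_arcs.induct) auto

lemma pcas_vwalk_arcs: "pcas u (vwalk_arcs (u # p)) (last (u # p))"
  by (induction p arbitrary: u) auto

lemma pawalk_verts_vwalk_arcs: "pawalk_verts u (vwalk_arcs (u # p)) = u # p"
  by (induction p arbitrary: u) auto

lemma pawalk_verts_Cons: "\<exists>p. pawalk_verts u es = u # p" if "pcas u es v"
  using that by (cases es) auto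

lemma pcas_walk:
  "pcas u es v \<Longrightarrow> vwalk_arcs (pawalk_verts u es) = es \<and> last (pawalk_verts u es) = v"
proof (induction es arbitrary: u)
  case (Cons e es)
  then have es: "pcas (snd e) es v" and u: "fst e = u" by simp_all
  obtain p where p: "pawalk_verts (snd e) es = snd e # p" using pawalk_verts_Cons[OF es] by blast
  show ?case using Cons.IH[OF es] u p by (cases e) simp
qed simp

text \<open>When the walk returns to a vertex of the path, the path is cut back to that
  vertex.\<close>

lemma rtrancl_path:
  assumes "(x, y) \<in> R\<^sup>*"
  shows "\<exists>p. last (x # p) = y \<and> distinct (x # p) \<and> successively (\<lambda>a b. (a, b) \<in> R) (x # p)"
  using assms
proof induction
  case base
  show ?case by (intro exI[of _ "[]"]) simp
next
  case (step y z)
  then obtain p where p: "last (x # p) = y" "distinct (x # p)"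
    "successively (\<lambda>a b. (a, b) \<in> R) (x # p)" by blast
  show ?case
  proof (cases "z \<in> set (x # p)")
    case True
    then obtain as bs where ab: "x # p = as @ z # bs" by (meson split_list)
    then have ab': "x # p = (as @ [z]) @ bs" by simp
    have "successively (\<lambda>a b. (a, b) \<in> R) (as @ [z])" "distinct (as @ [z])"
      using p(2,3) unfolding ab' by (auto simp: successively_append_iff)
    moreover obtain q where "as @ [z] = x # q" using ab by (cases as) auto
    ultimately show ?thesis by (metis last_snoc)
  next
    case False
    have "successively (\<lambda>a b. (a, b) \<in> R) ((x # p) @ [z])"
      using p(1,3) step(2) by (subst successively_append_iff) auto
    then show ?thesis using p(2) False by (intro exI[of _ "p @ [z]"]) auto
  qed
qed

text \<open>The cut set of \<open>uv\<close> consists of all vertices reachable from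
  \<open>u\<close> without this edge. If it contained \<open>v\<close>, a simple path closed up by
  the edge would be a cycle of length at least 3.\<close>

lemma undirected_tree_imp_cut_tree:
  assumes "undirected_tree (with_proj T)" shows "cut_tree (pverts T) (parcs T)"
proof -
  let ?E = "parcs T"
  interpret pair_graph T
    by (rule pair_graphI_graph) (use assms in \<open>simp add: undirected_tree_def\<close>)
  have sc: "strongly_connected (with_proj (mk_symmetric (with_proj T)))"
    and acyc: "\<And>p. pre_digraph.cycle (with_proj T) p \<Longrightarrow> length p < 3"
    using assms by (auto simp: undirected_tree_def connected_def not_le)
  \<comment> \<open>Connectedness is defined through the symmetrised digraph, which here has the
    same arcs.\<close>
  have sym: "parcs (mk_symmetric (with_proj T)) = ?E"
    using arcs_symmetric by (auto simp: mk_symmetric_def)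
  show ?thesis
  proof
    show "finite (pverts T)" by (rule pair_finite_verts)
    show "pverts T \<noteq> {}" using sc by (simp add: strongly_connected_def mk_symmetric_def)
    show "?E \<subseteq> pverts T \<times> pverts T" using in_arcsD1 in_arcsD2 by auto
    show "(b, a) \<in> ?E" if "(a, b) \<in> ?E" for a b using arcs_symmetric that .
    show "(x, y) \<in> ?E\<^sup>*" if "x \<in> pverts T" "y \<in> pverts T" for x y
    proof -
      have "x \<rightarrow>\<^sup>*\<^bsub>with_proj (mk_symmetric (with_proj T))\<^esub> y"
        using sc that by (simp add: strongly_connected_def mk_symmetric_def)
      from reachable_rtranclI[OF this] show ?thesis by (simp add: sym)
    qed
    fix u v assume uv: "(u, v) \<in> ?E"
    let ?F = "?E - {(u, v), (v, u)}"
    have ne: "u \<noteq> v" using uv no_loops' by blast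
    have "(u, v) \<notin> ?F\<^sup>*"
    proof
      assume "(u, v) \<in> ?F\<^sup>*"
      then obtain p where p: "last (u # p) = v" "distinct (u # p)"
        "successively (\<lambda>a b. (a, b) \<in> ?F) (u # p)" using rtrancl_path by metis
      obtain y ys where y: "p = y # ys" using p(1) ne by (cases p) auto
      \<comment> \<open>The path avoids the arc from \<open>u\<close> to \<open>v\<close>, so it has
        an inner vertex and the closed walk has at least three arcs.\<close>
      have "ys \<noteq> []" using p(1,3) y by auto
      then have len: "3 \<le> length (vwalk_arcs (u # p @ [u]))"
        using vwalk_length_simp[of "u # p @ [u]"] y by (cases ys) (simp_all add: vwalk_length_def)
      have "successively (\<lambda>a b. (a, b) \<in> ?E) (u # p)"
        by (rule successively_mono[OF p(3)]) simp
      then have "successively (\<lambda>a b. (a, b) \<in> ?E) ((u # p) @ [u])"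
        using p(1) arcs_symmetric[OF uv] by (subst successively_append_iff) simp
      then have arcs: "set (vwalk_arcs (u # p @ [u])) \<subseteq> ?E"
        unfolding vwalk_arcs_successively by simp
      have "pre_digraph.cycle (with_proj T) (vwalk_arcs (u # p @ [u]))"
        unfolding cycle_def
      proof (intro exI[of _ u] conjI)
        show "awalk u (vwalk_arcs (u # p @ [u])) u"
          unfolding awalk_def using arcs in_arcsD1[OF uv] pcas_vwalk_arcs[of u "p @ [u]"] by simp
        show "distinct (tl (awalk_verts u (vwalk_arcs (u # p @ [u]))))"
          using p(2) pawalk_verts_vwalk_arcs[of u "p @ [u]"] by simp
        show "vwalk_arcs (u # p @ [u]) \<noteq> []" using len by auto
      qed
      then show False using acyc len by fastforce
    qed
    moreover have "a = u \<and> b = v" if "(a, b) \<in> ?E" "(u, a) \<in> ?F\<^sup>*" "(u, b) \<notin> ?F\<^sup>*" for a b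
    proof -
      have "(a, b) \<notin> ?F" using that(2,3) by (meson rtrancl_into_rtrancl)
      then show ?thesis using that calculation by auto
    qed
    ultimately show "\<exists>S. u \<in> S \<and> v \<notin> S \<and> (\<forall>a b. (a, b) \<in> ?E \<longrightarrow> a \<in> S \<longrightarrow> b \<notin> S \<longrightarrow> a = u \<and> b = v)"
      by (intro exI[of _ "{z. (u, z) \<in> ?F\<^sup>*}"]) simp
  qed
qed

text \<open>The first arc of a cycle leaves its cut set, so the remaining arcs must return over the
  same edge. Distinctness of the vertices then leaves only \<open>(v, u)\<close>, and the length is
  2.\<close>

lemma cut_tree_imp_undirected_tree:
  assumes "cut_tree V E" shows "undirected_tree (with_proj \<lparr>pverts = V, parcs = E\<rparr>)"
proof -
  let ?T = "\<lparr>pverts = V, parcs = E\<rparr>"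
  interpret C: cut_tree V E by fact
  have finE: "finite E" using C.finite_V C.E_subset by (meson finite_SigmaI finite_subset)
  interpret pair_graph ?T
  proof
    show "symmetric (with_proj ?T)"
      using C.E_sym by (simp add: symmetric_def sym_def)
  next
    fix e assume "e \<in> parcs ?T"
    then obtain a b where ab: "e = (a, b)" "(a, b) \<in> E" by (cases e) simp
    then show "fst e \<in> pverts ?T" "snd e \<in> pverts ?T" "fst e \<noteq> snd e"
      using C.E_V[OF ab(2)] C.E_irrefl[of a] by auto
  qed (use C.finite_V finE in simp_all)
  have sym: "mk_symmetric (with_proj ?T) = ?T"
  proof -
    have "(\<Union>e\<in>E. {(fst e, snd e), (snd e, fst e)}) = E" using C.E_sym by auto
    then show ?thesis by (simp add: mk_symmetric_def)
  qed
  have "strongly_connected (with_proj ?T)"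
    unfolding strongly_connected_def using C.V_nonempty C.E_conn by (simp add: reachable_conv)
  moreover have False if cyc: "cycle p" and len: "3 \<le> length p" for p
  proof -
    obtain u where u: "awalk u p u" "distinct (tl (awalk_verts u p))" using cyc unfolding cycle_def by blast
    obtain e es where p: "p = e # es" using len by (cases p) auto
    obtain v where e: "e = (u, v)" and walk: "pcas v es u" and uv: "(u, v) \<in> E" and es: "set es \<subseteq> E"
      using u(1) unfolding awalk_def p by (cases e) auto
    obtain l where l: "pawalk_verts v es = v # l" using pawalk_verts_Cons[OF walk] by blast
    have w: "vwalk_arcs (v # l) = es" "last (v # l) = u" and d: "distinct (v # l)"
      using pcas_walk[OF walk] u(2) by (auto simp: l p e)
    obtain S where S: "u \<in> S" "v \<notin> S" "\<And>a b. (a, b) \<in> E \<Longrightarrow> a \<in> S \<Longrightarrow> b \<notin> S \<Longrightarrow> a = u \<and> b = v"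
      using C.E_cut[OF uv] by blast
    have "u \<in> set (v # l)" using w(2) by (metis last_in_set list.distinct(1))
    then obtain a b where ab: "a \<in> S" "b \<notin> S" "(a, b) \<in> set es \<or> (b, a) \<in> set es"
      using successively_crossing[of "\<lambda>a b. (a, b) \<in> set es" "v # l" u S v] S(1,2) w(1)
        vwalk_arcs_successively[of "v # l" "set es"] by auto
    then have "(a, b) \<in> E" using es C.E_sym by blast
    then have "a = u" "b = v" using S(3) ab by blast+
    \<comment> \<open>The list \<open>v # l\<close> is distinct and begins with \<open>v\<close>, so
      no later arc ends in \<open>v\<close>.\<close>
    moreover have "(u, v) \<notin> set es" using vwalk_arcs_memD[of u v "v # l"] w(1) d by auto
    ultimately have vu: "(v, u) \<in> set (vwalk_arcs (v # l))" using ab w by simp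
    obtain y ys where y: "l = y # ys" using vu by (cases l) auto
    have "y = u" using vu d vwalk_arcs_memD[of v u "y # ys"] by (auto simp: y)
    have "ys = []"
    proof (rule ccontr)
      assume ne: "ys \<noteq> []"
      then have "last ys = u" using w(2) y by simp
      then have "u \<in> set ys" using last_in_set[OF ne] by simp
      then show False using d y \<open>y = u\<close> by simp
    qed
    then have "es = [(v, u)]" using w(1) y \<open>y = u\<close> by simp
    then show False using len p by simp
  qed
  ultimately show ?thesis
    unfolding undirected_tree_def connected_def sym using pair_graphD_graph by blast
qed

lemma undirected_tree_iff: "undirected_tree (with_proj T) \<longleftrightarrow> cut_tree (pverts T) (parcs T)"
  using undirected_tree_imp_cut_tree[of T] cut_tree_imp_undirected_tree[of "pverts T" "parcs T"]
  by (cases T) auto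

lemma VPT_representation_iff:
  "VPT_representation G (with_proj T) P \<longleftrightarrow>
     path_rep (verts G) (dominates G) (pverts T) (parcs T) P"
  unfolding VPT_representation_def path_rep_def undirected_tree_iff vpath_with_proj by blast

lemma out_degree_with_proj: "out_degree (with_proj T) x = card {y. (x, y) \<in> parcs T}"
proof -
  have "out_arcs (with_proj T) x = Pair x ` {y. (x, y) \<in> parcs T}" by (auto simp: out_arcs_def)
  then show ?thesis by (simp add: out_degree_def card_image inj_on_def)
qed

section \<open>Renaming host vertices and deleting graph vertices\<close>

lemma cut_tree_image:
  assumes "cut_tree V E" "inj g" shows "cut_tree (g ` V) (map_prod g g ` E)"
proof -
  interpret cut_tree V E by fact
  have mem: "(g a, g b) \<in> map_prod g g ` E \<longleftrightarrow> (a, b) \<in> E" for a b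
    using assms(2) by (auto simp: inj_eq)
  show ?thesis
  proof
    show "finite (g ` V)" "g ` V \<noteq> {}" using finite_V V_nonempty by auto
    show "map_prod g g ` E \<subseteq> g ` V \<times> g ` V" using E_subset by auto
    show "(b, a) \<in> map_prod g g ` E" if "(a, b) \<in> map_prod g g ` E" for a b
      using that mem E_sym by auto
    show "(x, y) \<in> (map_prod g g ` E)\<^sup>*" if xy: "x \<in> g ` V" "y \<in> g ` V" for x y
    proof -
      obtain a b where ab: "a \<in> V" "b \<in> V" "x = g a" "y = g b" using xy by blast
      have "(g a, g b) \<in> (map_prod g g ` E)\<^sup>*" using E_conn[OF ab(1,2)]
      proof induction
        case (step c d)
        then show ?case using mem[of c d] by (meson rtrancl_into_rtrancl)
      qed simp
      then show ?thesis using ab by simp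
    qed
    fix x y assume "(x, y) \<in> map_prod g g ` E"
    then obtain u v where uv: "(u, v) \<in> E" "x = g u" "y = g v" by auto
    obtain S where S: "u \<in> S" "v \<notin> S" "\<And>a b. (a, b) \<in> E \<Longrightarrow> a \<in> S \<Longrightarrow> b \<notin> S \<Longrightarrow> a = u \<and> b = v"
      using E_cut[OF uv(1)] by blast
    have gS: "g a \<in> g ` S \<longleftrightarrow> a \<in> S" for a using assms(2) by (simp add: inj_image_mem_iff)
    have "a = x \<and> b = y" if ab: "(a, b) \<in> map_prod g g ` E" "a \<in> g ` S" "b \<notin> g ` S" for a b
    proof -
      obtain c d where cd: "(c, d) \<in> E" "a = g c" "b = g d" using ab(1) by auto
      then have "c = u \<and> d = v" using S(3)[OF cd(1)] ab(2,3) gS by simp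
      then show ?thesis using cd uv by simp
    qed
    moreover have "x \<in> g ` S" "y \<notin> g ` S" using S(1,2) uv gS by simp_all
    ultimately show "\<exists>S. x \<in> S \<and> y \<notin> S \<and>
      (\<forall>a b. (a, b) \<in> map_prod g g ` E \<longrightarrow> a \<in> S \<longrightarrow> b \<notin> S \<longrightarrow> a = x \<and> b = y)" by blast
  qed
qed

lemma path_rep_image:
  assumes rep: "path_rep W A V E P" and g: "inj g"
  shows "path_rep W A (g ` V) (map_prod g g ` E) (\<lambda>w. map g (P w))"
proof -
  have "tree_path (g ` V) (map_prod g g ` E) (map g p)" if "tree_path V E p" for p
  proof -
    have "successively (\<lambda>a b. (g a, g b) \<in> map_prod g g ` E) p"
      using that by (auto simp: tree_path_def elim: successively_mono)
    then show ?thesis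
      using that g by (auto simp: tree_path_def successively_map distinct_map inj_on_def)
  qed
  moreover have "set (map g p) \<inter> set (map g q) \<noteq> {} \<longleftrightarrow> set p \<inter> set q \<noteq> {}" for p q
    using g by (metis image_Int image_is_empty list.set_map)
  ultimately show ?thesis
    using rep cut_tree_image[OF _ g] unfolding path_rep_def by simp
qed

text \<open>Spider trees have pairs as vertices, whereas the class asks for natural numbers; an
  injection preserves intersections and degrees.\<close>

lemma class_h21I:
  fixes g :: "'t \<Rightarrow> nat" and V :: "'t set"
  assumes "graph G" and rep: "path_rep (verts G) (dominates G) V E P" and g: "inj g"
    and deg: "\<And>x. x \<in> V \<Longrightarrow> card {y. (x, y) \<in> E} \<le> h"
  shows "G \<in> class_h21 h"
proof -
  let ?T = "\<lparr>pverts = g ` V, parcs = map_prod g g ` E\<rparr>"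
  have "VPT_representation G (with_proj ?T) (\<lambda>w. map g (P w))"
    unfolding VPT_representation_iff using path_rep_image[OF rep g] by simp
  moreover have "out_degree (with_proj ?T) x \<le> h" if x: "x \<in> verts (with_proj ?T)" for x
  proof -
    obtain a where a: "a \<in> V" "x = g a" using x by auto
    have "{y. (x, y) \<in> map_prod g g ` E} = g ` {b. (a, b) \<in> E}"
      using g a(2) by (auto simp: inj_eq)
    then have "out_degree (with_proj ?T) x = card (g ` {b. (a, b) \<in> E})"
      by (simp add: out_degree_with_proj)
    also have "\<dots> = card {b. (a, b) \<in> E}" by (rule card_image[OF inj_on_subset[OF g subset_UNIV]])
    finally show ?thesis using deg[OF a(1)] by simp
  qed
  ultimately show ?thesis using assms(1) unfolding class_h21_def by blast
qed

lemma path_rep_del_vert: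
  assumes "path_rep (verts (pre_digraph.del_vert G w)) (dominates (pre_digraph.del_vert G w)) V E P"
  shows "path_rep (verts G - {w}) (dominates G) V E P"
proof -
  have "verts (pre_digraph.del_vert G w) = verts G - {w}" by (simp add: pre_digraph.del_vert_def)
  moreover have "u \<rightarrow>\<^bsub>pre_digraph.del_vert G w\<^esub> v \<longleftrightarrow> u \<rightarrow>\<^bsub>G\<^esub> v" if "u \<noteq> w" "v \<noteq> w" for u v
    using that by (auto simp: pre_digraph.del_vert_def arcs_ends_conv)
  ultimately show ?thesis using assms unfolding path_rep_def by auto
qed

theorem theorem11:
  fixes G :: "('a, 'b) pre_digraph" and h :: nat
  assumes "graph G" and "Digraph_Component.connected G"
    and "G \<in> VPT"
    and "3 \<le> h"
    and "minimal_non_h21 h G"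
  shows "G \<in> class_h21 (h + 1)"
proof -
  obtain T0 :: "nat pair_pre_digraph" and P0 where "VPT_representation G (with_proj T0) P0"
    using assms(3) unfolding VPT_def by blast
  then have "path_rep (verts G) (dominates G) (pverts T0) (parcs T0) P0"
    by (simp only: VPT_representation_iff)
  then obtain V :: "nat set" and E P where rep: "path_rep (verts G) (dominates G) V E P"
    and red: "reduced_rep (verts G) E P" by (rule exists_reduced_rep)
  have del: "\<exists>(V' :: nat set) E' P'. path_rep (verts G - {w}) (dominates G) V' E' P' \<and>
      (\<forall>x\<in>V'. card {y. (x, y) \<in> E'} \<le> h)" if w: "w \<in> verts G" for w
  proof -
    have "pre_digraph.del_vert G w \<in> class_h21 h"
      using assms(5) w unfolding minimal_non_h21_def by blast
    then obtain T :: "nat pair_pre_digraph" and P' where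
      T: "VPT_representation (pre_digraph.del_vert G w) (with_proj T) P'"
      "\<And>x. x \<in> verts (with_proj T) \<Longrightarrow> out_degree (with_proj T) x \<le> h"
      unfolding class_h21_def by blast
    have "path_rep (verts G - {w}) (dominates G) (pverts T) (parcs T) P'"
      using T(1) unfolding VPT_representation_iff by (rule path_rep_del_vert)
    moreover have "card {y. (x, y) \<in> parcs T} \<le> h" if "x \<in> pverts T" for x
      using T(2)[of x] that by (simp add: out_degree_with_proj)
    ultimately show ?thesis by blast
  qed
  \<comment> \<open>The colourings at different vertices \<open>q\<close> are unrelated; only their
    sizes and properness at each \<open>q\<close> matter.\<close>
  let ?good = "\<lambda>q (c :: nat \<Rightarrow> nat option). card (c ` {r. (q, r) \<in> E}) \<le> h + 1 \<and>
    (\<forall>x\<in>verts G. \<forall>i j. {q, i, j} \<subseteq> set (P x) \<longrightarrow> (q, i) \<in> E \<longrightarrow> (q, j) \<in> E \<longrightarrow> i \<noteq> j \<longrightarrow> c i \<noteq> c j)"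
  have "\<exists>c. ?good q c" if "q \<in> V" for q
    using branch_colouring[OF rep red that del] .
  then have "\<exists>f. \<forall>q\<in>V. ?good q (f q)" by (intro bchoice ballI)
  then obtain f where f: "\<forall>q\<in>V. ?good q (f q)" ..
  have "\<exists>(V' :: (nat \<times> nat) set) E' P'. path_rep (verts G) (dominates G) V' E' P' \<and>
    (\<forall>x\<in>V'. card {y. (x, y) \<in> E'} \<le> h + 1)"
  proof (rule expand_rep[OF rep])
    fix x q i j
    assume a: "x \<in> verts G" "{q, i, j} \<subseteq> set (P x)" "(q, i) \<in> E" "(q, j) \<in> E" "i \<noteq> j"
    have "q \<in> V" using cut_tree.E_V(1)[OF path_repD(1)[OF rep] a(3)] .
    then show "f q i \<noteq> f q j" using f a by blast
  next
    show "card (f q ` {r. (q, r) \<in> E}) \<le> h + 1" if "q \<in> V" for q using f that by blast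
    show "3 \<le> h + 1" using assms(4) by simp
  qed
  then obtain V' :: "(nat \<times> nat) set" and E' P' where
    rep': "path_rep (verts G) (dominates G) V' E' P'" and
    deg: "\<And>x. x \<in> V' \<Longrightarrow> card {y. (x, y) \<in> E'} \<le> h + 1" by blast
  \<comment> \<open>\<open>prod_encode\<close> numbers the pairs that are the vertices of the spider
    tree.\<close>
  show ?thesis using class_h21I[OF assms(1) rep' inj_prod_encode deg] .
qed

end
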